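(* Let $\mathscr{U}=(U,\mathcal{A},\lambda)$ be a linear reflexive object in a Cartesian closed differential category. Let $S,T$ be differential $\lambda$-terms, $\vec x=x_1,\dots,x_n$ a sequence of distinct variables and $y$ a variable not occurring in $\vec x$, such that $\vec x,y$ is adequate for $S$ and $\vec x$ is adequate for $T$. Then $[\![S\{T/y\}]\!]_{\vec x}=[\![S]\!]_{\vec x,y}\circ\langle\mathrm{Id},[\![T]\!]_{\vec x}\rangle$.
   Context: Cartesian closed differential category: a category with commutative-monoid homsets $(+,0)$ satisfying $(g+h)\circ f=g\circ f+h\circ f$, $0\circ f=0$, with finite products whose projections are additive ($f\circ(g+h)=f\circ g+f\circ h$, $f\circ0=0$) and pairings of additive maps additive, with an operator $D$ sending $f:A\to B$ to $D(f):A\times A\to B$ satisfying (D1) $D(f+g)=D(f)+D(g)$, $D(0)=0$; (D2) $D(f)\circ\langle h+k,v\rangle=D(f)\circ\langle h,v\rangle+D(f)\circ\langle k,v\rangle$, $D(f)\circ\langle0,v\rangle=0$; (D3) $D(\mathrm{Id})=\pi_1$, $D(\pi_1)=\pi_1\circ\pi_1$, $D(\pi_2)=\pi_2\circ\pi_1$; (D4) $D\langle f,g\rangle=\langle D(f),D(g)\rangle$; (D5) $D(f\circ g)=D(f)\circ\langle D(g),g\circ\pi_2\rangle$; (D6) $D(D(f))\circ\langle\langle g,0\rangle,\langle h,k\rangle\rangle=D(f)\circ\langle g,k\rangle$; (D7) $D(D(f))\circ\langle\langle0,h\rangle,\langle g,k\rangle\rangle=D(D(f))\circ\langle\langle0,g\rangle,\langle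 h,k\rangle\rangle$; which is Cartesian closed (exponential $[A\Rightarrow B]$, $\mathrm{ev}$, currying $\Lambda$) with $\Lambda(f+g)=\Lambda(f)+\Lambda(g)$, $\Lambda(0)=0$ and $D(\Lambda(f))=\Lambda(D(f)\circ\langle\pi_1\times0_A,\pi_2\times\mathrm{Id}_A\rangle)$ for $f:C\times A\to B$. $\Lambda^-(h)=\mathrm{ev}\circ(h\times\mathrm{Id})$. $f$ is linear if $D(f)=f\circ\pi_1$. For $f:C\times A\to B$, $g:C\to A$: $f\star g=D(f)\circ\langle\langle0_C,g\circ\pi_1\rangle,\mathrm{Id}_{C\times A}\rangle$. A linear reflexive object is $(U,\mathcal{A},\lambda)$ with $\mathcal{A}:U\to[U\Rightarrow U]$, $\lambda:[U\Rightarrow U]\to U$, $\mathcal{A}\circ\lambda=\mathrm{Id}$, both linear. Differential $\lambda$-terms $S,T::=0\mid s\mid s+T$, simple terms $s,t::=x\mid\lambda x.s\mid sT\mid\mathsf{D}s\cdot t$, modulo $\alpha$-conversion, AC of $+$ with unit $0$, and permutation of the arguments of iterated linear application $\mathsf{D}^ns\cdot(t_1,\dots,t_n)$ (where $\mathsf{D}^1s\cdot t=\mathsf{D}s\cdot t$, $\mathsf{D}^{n+1}s\cdot(t,t_1,\dots,t_n)=\mathsf{D}^n(\mathsf{D}s\cdot t)\cdot(t_1,\dots,t_n)$); abbreviations $\lambda x.\sum s_i=\sum\lambda x.s_i$, $(\sum s_i)T=\sum s_iT$, $\mathsf{D}(\sum s_i)\cdot(\sum t_j)=\sum\mathsf{D}s_i\cdot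 t_j$. $S\{T/y\}$ is the usual capture-avoiding substitution of $T$ for all free occurrences of $y$, acting componentwise on all constructors, with $0\{T/y\}=0$. Interpretation: for distinct variables $\vec x=x_1,\dots,x_n$, $U^{\vec x}=U^{x_1..x_{n-1}}\times U$ (empty sequence: terminal object), $\pi^{\vec x}_n=\pi_2$, $\pi^{\vec x}_i=\pi^{x_1..x_{n-1}}_i\circ\pi_1$; $\vec x$ adequate for $S$ if it contains all free variables of $S$. $[\![x_i]\!]_{\vec x}=\pi_i^{\vec x}$; $[\![sT]\!]=\mathrm{ev}\circ\langle\mathcal{A}\circ[\![s]\!],[\![T]\!]\rangle$; $[\![\lambda z.s]\!]_{\vec x}=\lambda\circ\Lambda([\![s]\!]_{\vec x,z})$; $[\![\mathsf{D}^1s\cdot t]\!]=\lambda\circ\Lambda(\Lambda^-(\mathcal{A}\circ[\![s]\!])\star[\![t]\!])$; $[\![\mathsf{D}^{n+1}s\cdot(t_1..t_{n+1})]\!]=\lambda\circ\Lambda(\Lambda^-(\mathcal{A}\circ[\![\mathsf{D}^ns\cdot(t_1..t_n)]\!])\star[\![t_{n+1}]\!])$; $[\![0]\!]=0$; $[\![s+S]\!]=[\![s]\!]+[\![S]\!]$. *)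

theory Defs
  imports "HOL-Library.Multiset" "HOL-Combinatorics.Transposition"
begin

section \<open>Differential lambda-terms\<close>

text \<open>
  Raw syntax. A list of simple terms is a formal sum: the empty list is \<open>0\<close>, \<open>s # T\<close> is \<open>s + T\<close>,
  and a simple term \<open>s\<close> used as a sum is \<open>[s]\<close>, i.e. \<open>s + 0\<close>. \<open>Lin s t\<close> is the linear application
  \<open>D s \<cdot> t\<close>, so that \<open>Lin (... (Lin s t1) ...) tn\<close> is the iterated one.
\<close>

datatype 'v simple =
    Var 'v
  | Lam 'v "'v simple"
  | App "'v simple" "'v simple list"
  | Lin "'v simple" "'v simple"

type_synonym var = nat
type_synonym raw = "var simple list"

primrec fv :: "'v simple \<Rightarrow> 'v set" where
  "fv (Var x) = {x}"
| "fv (Lam z s) = fv s - {z}"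
| "fv (App s T) = fv s \<union> \<Union> (set (map fv T))"
| "fv (Lin s t) = fv s \<union> fv t"

definition fvs :: "'v simple list \<Rightarrow> 'v set" where
  "fvs S = (\<Union>s\<in>set S. fv s)"

text \<open>
  Rule \<open>alpha\<close> renames the bound variable by exchanging two names throughout the body.
  Rule \<open>perm\<close> transposes two adjacent arguments of an iterated linear application; such
  transpositions generate all permutations. Sums are compared as multisets, which is
  associativity and commutativity of \<open>+\<close> with unit \<open>0\<close>.
\<close>

inductive simple_eq :: "'v simple \<Rightarrow> 'v simple \<Rightarrow> bool" where
  refl: "simple_eq s s"
| sym: "simple_eq s t \<Longrightarrow> simple_eq t s"
| trans: "simple_eq s t \<Longrightarrow> simple_eq t u \<Longrightarrow> simple_eq s u"
| alpha: "z \<notin> fv (Lam x s) \<Longrightarrow> simple_eq (Lam x s) (Lam z (map_simple (transpose x z) s))"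
| perm: "simple_eq (Lin (Lin s t) u) (Lin (Lin s u) t)"
| Lam: "simple_eq s s' \<Longrightarrow> simple_eq (Lam x s) (Lam x s')"
| App: "simple_eq s s' \<Longrightarrow> rel_mset simple_eq (mset T) (mset T') \<Longrightarrow> simple_eq (App s T) (App s' T')"
| Lin: "simple_eq s s' \<Longrightarrow> simple_eq t t' \<Longrightarrow> simple_eq (Lin s t) (Lin s' t')"
monos multiset.rel_mono

definition raw_eq :: "'v simple list \<Rightarrow> 'v simple list \<Rightarrow> bool" where
  "raw_eq S T \<longleftrightarrow> rel_mset simple_eq (mset S) (mset T)"

text \<open>The abbreviations extending abstraction, application and linear application to sums.\<close>

definition lam_sum :: "'v \<Rightarrow> 'v simple list \<Rightarrow> 'v simple list" where
  "lam_sum z S = map (Lam z) S"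

definition app_sum :: "'v simple list \<Rightarrow> 'v simple list \<Rightarrow> 'v simple list" where
  "app_sum S T = map (\<lambda>s. App s T) S"

definition lin_sum :: "'v simple list \<Rightarrow> 'v simple list \<Rightarrow> 'v simple list" where
  "lin_sum S T = concat (map (\<lambda>s. map (Lin s) T) S)"

definition fresh :: "var set \<Rightarrow> var" where
  "fresh X = (LEAST z. z \<notin> X)"

text \<open>
  Capture-avoiding substitution, in its simultaneous form: going under \<open>Lam z\<close>, the bound
  variable is always renamed to one not free in any term substituted for a free variable
  of \<open>Lam z s\<close>. Working modulo alpha-conversion, this is the usual substitution.
\<close>

primrec psubst :: "var simple \<Rightarrow> (var \<Rightarrow> raw) \<Rightarrow> raw" where
  "psubst (Var x) \<rho> = \<rho> x"
| "psubst (Lam z s) \<rho> =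
     (let z' = fresh (\<Union>v\<in>fv (Lam z s). fvs (\<rho> v))
      in lam_sum z' (psubst s (\<rho>(z := [Var z']))))"
| "psubst (App s T) \<rho> = app_sum (psubst s \<rho>) (concat (map (\<lambda>t. psubst t \<rho>) T))"
| "psubst (Lin s t) \<rho> = lin_sum (psubst s \<rho>) (psubst t \<rho>)"

definition raw_subst :: "raw \<Rightarrow> raw \<Rightarrow> var \<Rightarrow> raw" where
  "raw_subst S T y = concat (map (\<lambda>s. psubst s ((\<lambda>v. [Var v])(y := T))) S)"

subsection \<open>Differential lambda-terms as equivalence classes\<close>

lemma raw_eq_refl: "raw_eq S S"
  unfolding raw_eq_def by (rule multiset.rel_refl) (rule simple_eq.refl)

lemma raw_eq_sym: "raw_eq S T \<Longrightarrow> raw_eq T S"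
  unfolding raw_eq_def
  by (subst multiset.rel_flip[symmetric]) (auto elim!: multiset.rel_mono_strong intro: simple_eq.sym)

lemma raw_eq_trans: "raw_eq S T \<Longrightarrow> raw_eq T R \<Longrightarrow> raw_eq S R"
  unfolding raw_eq_def
  by (drule (1) relcomppI) (auto simp: multiset.rel_compp[symmetric] elim!: multiset.rel_mono_strong intro: simple_eq.trans)

quotient_type dterm = raw / raw_eq
  by (intro equivpI reflpI sympI transpI) (blast intro: raw_eq_refl raw_eq_sym raw_eq_trans)+

lemma rel_mset_ind [consumes 1, case_names empty add]:
  assumes "rel_mset R M N" and "P {#} {#}"
    and step: "\<And>a b M N. R a b \<Longrightarrow> P M N \<Longrightarrow> P (add_mset a M) (add_mset b N)"
  shows "P M N"
proof -
  from assms(1) obtain xs ys where "mset xs = M" "mset ys = N" and "list_all2 R xs ys"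
    by (auto simp: rel_mset_def)
  moreover from this(3) have "P (mset xs) (mset ys)"
    by (induction rule: list_all2_induct) (auto intro: assms(2) step)
  ultimately show ?thesis by simp
qed

lemma rel_mset_sum_mset:
  "rel_mset (\<lambda>x y. rel_mset R (f x) (g y)) M N
    \<Longrightarrow> rel_mset R (\<Sum>x\<in>#M. f x) (\<Sum>y\<in>#N. g y)"
proof (induction rule: rel_mset_ind)
  case empty
  then show ?case by simp
next
  case (add a b M N)
  have union: "rel_mset R (A + C) (B + D)" if "rel_mset R A B" "rel_mset R C D" for A B C D
    using that by (induction rule: rel_mset_ind) (auto intro: rel_mset_Plus)
  show ?case using add by (simp add: union)
qed

lemma rel_mset_image:
  "rel_mset (\<lambda>x y. R (f x) (g y)) M N \<Longrightarrow> rel_mset R (image_mset f M) (image_mset g N)"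
  by (simp add: multiset.rel_map)

lemma fv_map_simple: "inj p \<Longrightarrow> fv (map_simple p s) = p ` fv s"
  by (induction s) (auto simp: inj_image_mem_iff image_set_diff)

lemma simple_eq_fv: "simple_eq s t \<Longrightarrow> fv s = fv t"
proof (induction rule: simple_eq.induct)
  case (alpha z x s)
  from alpha show ?case
    by (simp add: fv_map_simple inj_transpose del: fv.simps(1)) (auto simp: transpose_def split: if_splits)
next
  case (App s s' T T')
  have "(\<Union>t\<in>set_mset (mset T). fv t) = (\<Union>t\<in>set_mset (mset T'). fv t)"
    using App(3) by (induction rule: rel_mset_ind) auto
  with App(2) show ?case by simp
qed auto

lemma raw_eq_fvs: 
  assumes "raw_eq S T" shows "fvs S = fvs T"
proof -
  have "(\<Union>s\<in>set_mset (mset S). fv s) = (\<Union>s\<in>set_mset (mset T). fv s)"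
    using assms unfolding raw_eq_def
    by (induction rule: rel_mset_ind) (auto dest: simple_eq_fv)
  then show ?thesis by (simp add: fvs_def)
qed

lemma raw_eq_lam_sum: "raw_eq S T \<Longrightarrow> raw_eq (lam_sum z S) (lam_sum z T)"
  unfolding raw_eq_def lam_sum_def mset_map
  by (rule rel_mset_image) (auto elim: multiset.rel_mono_strong intro: simple_eq.Lam)

lemma raw_eq_app_sum: "raw_eq S S' \<Longrightarrow> raw_eq T T' \<Longrightarrow> raw_eq (app_sum S T) (app_sum S' T')"
  unfolding raw_eq_def app_sum_def mset_map
  by (rule rel_mset_image) (auto elim: multiset.rel_mono_strong intro: simple_eq.App)

lemma mset_lin_sum: "mset (lin_sum S T) = (\<Sum>s\<in>#mset S. image_mset (Lin s) (mset T))"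
  unfolding lin_sum_def by (induction S) auto

lemma raw_eq_lin_sum: "raw_eq S S' \<Longrightarrow> raw_eq T T' \<Longrightarrow> raw_eq (lin_sum S T) (lin_sum S' T')"
  unfolding raw_eq_def mset_lin_sum
  by (rule rel_mset_sum_mset, erule multiset.rel_mono_strong, rule rel_mset_image)
    (auto elim: multiset.rel_mono_strong intro: simple_eq.Lin)

lemma mset_concat_map: "mset (concat (map f T)) = (\<Sum>t\<in>#mset T. mset (f t))"
  by (induction T) auto

lemma raw_eq_concat_map:
  "rel_mset (\<lambda>s t. raw_eq (f s) (g t)) (mset S) (mset T)
    \<Longrightarrow> raw_eq (concat (map f S)) (concat (map g T))"
  unfolding raw_eq_def mset_concat_map by (rule rel_mset_sum_mset)

lemma raw_eq_lin_sum_perm: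
  "raw_eq (lin_sum (lin_sum S T) R) (lin_sum (lin_sum S R) T)"
proof -
  have expand: "mset (lin_sum (lin_sum S A) B)
      = (\<Sum>s\<in>#mset S. \<Sum>a\<in>#mset A. \<Sum>b\<in>#mset B. {#Lin (Lin s a) b#})" for A B
    unfolding mset_lin_sum by (induction S) (simp_all add: image_mset.compositionality comp_def)
  have "mset (lin_sum (lin_sum S R) T)
      = (\<Sum>s\<in>#mset S. \<Sum>t\<in>#mset T. \<Sum>r\<in>#mset R. {#Lin (Lin s r) t#})"
    unfolding expand by (subst sum_mset.swap) simp
  then show ?thesis
    unfolding raw_eq_def
    by (simp only: expand)
      (intro rel_mset_sum_mset multiset.rel_refl rel_mset_Plus rel_mset_Zero simple_eq.perm)
qed

lemma psubst_cong: "(\<And>v. v \<in> fv s \<Longrightarrow> \<rho> v = \<rho>' v) \<Longrightarrow> psubst s \<rho> = psubst s \<rho>'"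
proof (induction s arbitrary: \<rho> \<rho>')
  case (Lam z s)
  then have "(\<Union>v\<in>fv (Lam z s). fvs (\<rho> v)) = (\<Union>v\<in>fv (Lam z s). fvs (\<rho>' v))" by auto
  moreover have "psubst s (\<rho>(z := [Var z'])) = psubst s (\<rho>'(z := [Var z']))" for z'
    using Lam.prems by (intro Lam.IH) auto
  ultimately show ?case by (simp only: psubst.simps Let_def)
next
  case (App s T)
  have "psubst s \<rho> = psubst s \<rho>'" using App.prems by (intro App.IH(1)) auto
  moreover have "map (\<lambda>t. psubst t \<rho>) T = map (\<lambda>t. psubst t \<rho>') T"
    using App.prems by (intro map_cong[OF HOL.refl] App.IH(2)) auto
  ultimately show ?case by (simp only: psubst.simps)
next
  case (Lin s t)
  have "psubst s \<rho> = psubst s \<rho>'" using Lin.prems by (intro Lin.IH(1)) auto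
  moreover have "psubst t \<rho> = psubst t \<rho>'" using Lin.prems by (intro Lin.IH(2)) auto
  ultimately show ?case by simp
qed auto

lemma psubst_map_simple: "inj p \<Longrightarrow> psubst (map_simple p s) \<rho> = psubst s (\<rho> \<circ> p)"
proof (induction s arbitrary: \<rho>)
  case (Lam z s)
  have "(\<rho>(p z := T)) \<circ> p = (\<rho> \<circ> p)(z := T)" for T
    using Lam.prems by (auto simp: inj_eq)
  moreover have "(\<Union>v\<in>fv (map_simple p (Lam z s)). fvs (\<rho> v)) = (\<Union>v\<in>fv (Lam z s). fvs ((\<rho> \<circ> p) v))"
    using Lam.prems by (auto simp: fv_map_simple simp del: fv.simps simple.map)
  ultimately show ?case
    using Lam by (simp only: psubst.simps simple.map Let_def)
next
  case (App s T)
  then show ?case by (auto simp: comp_def cong: map_cong)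
qed auto

lemma psubst_eq_env: "(\<And>v. raw_eq (\<rho> v) (\<rho>' v)) \<Longrightarrow> raw_eq (psubst s \<rho>) (psubst s \<rho>')"
proof (induction s arbitrary: \<rho> \<rho>')
  case (Lam z s)
  then have "(\<Union>v\<in>fv (Lam z s). fvs (\<rho> v)) = (\<Union>v\<in>fv (Lam z s). fvs (\<rho>' v))"
    by (metis raw_eq_fvs)
  moreover have "raw_eq (psubst s (\<rho>(z := [Var z']))) (psubst s (\<rho>'(z := [Var z'])))" for z'
    using Lam.prems by (intro Lam.IH) (auto simp: raw_eq_refl)
  ultimately show ?case by (simp only: psubst.simps Let_def raw_eq_lam_sum)
next
  case (App s T)
  then show ?case
    by (auto intro!: raw_eq_app_sum raw_eq_concat_map multiset.rel_refl_strong)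
qed (auto intro: raw_eq_lin_sum)

lemma psubst_simple_eq: "simple_eq s s' \<Longrightarrow> raw_eq (psubst s \<rho>) (psubst s' \<rho>)"
proof (induction arbitrary: \<rho> rule: simple_eq.induct)
  case (alpha z x s)
  let ?s = "map_simple (transpose x z) s"
  have "psubst ?s (\<rho>(z := T)) = psubst s (\<rho>(x := T))" for T
    using alpha by (subst psubst_map_simple) (auto intro!: psubst_cong simp: transpose_def)
  moreover have "fv (Lam z ?s) = fv (Lam x s)"
    by (rule simple_eq_fv[OF simple_eq.alpha[OF alpha], symmetric])
  ultimately show ?case by (simp only: psubst.simps Let_def raw_eq_refl)
next
  case (Lam s s' x)
  then have "fv (Lam x s) = fv (Lam x s')" by (auto dest: simple_eq_fv)
  with Lam show ?case by (simp only: psubst.simps Let_def raw_eq_lam_sum)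
next
  case (App s s' T T')
  then show ?case
    by (auto intro!: raw_eq_app_sum raw_eq_concat_map elim!: multiset.rel_mono_strong)
next
  case (trans s t u)
  from raw_eq_trans[OF trans.IH] show ?case .
next
  case (sym s t)
  from raw_eq_sym[OF sym.IH] show ?case .
qed (simp_all add: raw_eq_refl raw_eq_lin_sum raw_eq_lin_sum_perm)

lemma psubst_eq:
  assumes "simple_eq s s'" "\<And>v. raw_eq (\<rho> v) (\<rho>' v)"
  shows "raw_eq (psubst s \<rho>) (psubst s' \<rho>')"
  by (rule raw_eq_trans[OF psubst_simple_eq[OF assms(1)] psubst_eq_env[OF assms(2)]])

lift_definition fvars :: "dterm \<Rightarrow> var set" is fvs
  by (rule raw_eq_fvs)

lift_definition subst :: "dterm \<Rightarrow> dterm \<Rightarrow> var \<Rightarrow> dterm" is raw_subst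
proof -
  fix S S' T T' :: raw and y
  assume S: "raw_eq S S'" and T: "raw_eq T T'"
  have "rel_mset (\<lambda>s s'. raw_eq (psubst s ((\<lambda>v. [Var v])(y := T)))
      (psubst s' ((\<lambda>v. [Var v])(y := T')))) (mset S) (mset S')"
    using S unfolding raw_eq_def[of S S']
    by (rule multiset.rel_mono_strong) (simp add: psubst_eq raw_eq_refl T)
  then show "raw_eq (raw_subst S T y) (raw_subst S' T' y)"
    unfolding raw_subst_def by (rule raw_eq_concat_map)
qed

definition adequate :: "var list \<Rightarrow> dterm \<Rightarrow> bool" where
  "adequate xs S \<longleftrightarrow> fvars S \<subseteq> set xs"

section \<open>Cartesian closed differential categories\<close>

text \<open>\<open>\<Lambda> X A f\<close> is the currying of \<open>f : X \<otimes> A \<rightarrow> B\<close>: as the product need not be injective on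
  objects, the two factors cannot be read off the domain of \<open>f\<close>.\<close>

record ('o, 'm) ccdc =
  Obj :: "'o set"
  Arr :: "'m set"
  Dom :: "'m \<Rightarrow> 'o"
  Cod :: "'m \<Rightarrow> 'o"
  Comp :: "'m \<Rightarrow> 'm \<Rightarrow> 'm" (infixr "\<cdot>\<index>" 70)
  Ident :: "'o \<Rightarrow> 'm" ("\<I>\<index>")
  Add :: "'m \<Rightarrow> 'm \<Rightarrow> 'm" (infixl "\<oplus>\<index>" 65)
  Zero :: "'o \<Rightarrow> 'o \<Rightarrow> 'm" ("\<zero>\<index>")
  One :: 'o ("\<one>\<index>")
  Prod :: "'o \<Rightarrow> 'o \<Rightarrow> 'o" (infixr "\<otimes>\<index>" 75)
  Proj1 :: "'o \<Rightarrow> 'o \<Rightarrow> 'm" ("\<pi>\<^sub>1\<index>")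
  Proj2 :: "'o \<Rightarrow> 'o \<Rightarrow> 'm" ("\<pi>\<^sub>2\<index>")
  Pairing :: "'m \<Rightarrow> 'm \<Rightarrow> 'm" ("\<llangle>_, _\<rrangle>\<index>")
  Exp :: "'o \<Rightarrow> 'o \<Rightarrow> 'o" (infixr "\<Rrightarrow>\<index>" 75)
  Eval :: "'o \<Rightarrow> 'o \<Rightarrow> 'm" ("\<E>\<index>")
  Curry :: "'o \<Rightarrow> 'o \<Rightarrow> 'm \<Rightarrow> 'm" ("\<Lambda>\<index>")
  Diff :: "'m \<Rightarrow> 'm" ("\<D>\<index>")

definition Hom :: "('o, 'm, 'x) ccdc_scheme \<Rightarrow> 'o \<Rightarrow> 'o \<Rightarrow> 'm set" where
  "Hom C A B = {f \<in> Arr C. Dom C f = A \<and> Cod C f = B}"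

locale category =
  fixes C :: "('o, 'm, 'x) ccdc_scheme" (structure)
  assumes Dom_Obj: "f \<in> Arr C \<Longrightarrow> Dom C f \<in> Obj C"
    and Cod_Obj: "f \<in> Arr C \<Longrightarrow> Cod C f \<in> Obj C"
    and Ident_Hom: "A \<in> Obj C \<Longrightarrow> \<I> A \<in> Hom C A A"
    and Comp_Hom: "f \<in> Hom C A B \<Longrightarrow> g \<in> Hom C B E \<Longrightarrow> g \<cdot> f \<in> Hom C A E"
    and Comp_assoc: "f \<in> Hom C A B \<Longrightarrow> g \<in> Hom C B E \<Longrightarrow> h \<in> Hom C E F
      \<Longrightarrow> (h \<cdot> g) \<cdot> f = h \<cdot> (g \<cdot> f)"
    and Ident_left: "f \<in> Hom C A B \<Longrightarrow> \<I> B \<cdot> f = f"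
    and Ident_right: "f \<in> Hom C A B \<Longrightarrow> f \<cdot> \<I> A = f"

locale left_additive_category = category +
  assumes Zero_Hom: "A \<in> Obj C \<Longrightarrow> B \<in> Obj C \<Longrightarrow> \<zero> A B \<in> Hom C A B"
    and Add_Hom: "f \<in> Hom C A B \<Longrightarrow> g \<in> Hom C A B \<Longrightarrow> f \<oplus> g \<in> Hom C A B"
    and Add_assoc: "f \<in> Hom C A B \<Longrightarrow> g \<in> Hom C A B \<Longrightarrow> h \<in> Hom C A B
      \<Longrightarrow> (f \<oplus> g) \<oplus> h = f \<oplus> (g \<oplus> h)"
    and Add_commute: "f \<in> Hom C A B \<Longrightarrow> g \<in> Hom C A B \<Longrightarrow> f \<oplus> g = g \<oplus> f"
    and Zero_Add: "f \<in> Hom C A B \<Longrightarrow> \<zero> A B \<oplus> f = f"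
    and Add_Comp: "f \<in> Hom C A B \<Longrightarrow> g \<in> Hom C B E \<Longrightarrow> h \<in> Hom C B E
      \<Longrightarrow> (g \<oplus> h) \<cdot> f = (g \<cdot> f) \<oplus> (h \<cdot> f)"
    and Zero_Comp: "f \<in> Hom C A B \<Longrightarrow> E \<in> Obj C \<Longrightarrow> \<zero> B E \<cdot> f = \<zero> A E"

definition additive_arr :: "('o, 'm, 'x) ccdc_scheme \<Rightarrow> 'm \<Rightarrow> bool" where
  "additive_arr C f \<longleftrightarrow> f \<in> Arr C \<and>
     (\<forall>X\<in>Obj C.
        (\<forall>g\<in>Hom C X (Dom C f). \<forall>h\<in>Hom C X (Dom C f).
           f \<cdot>\<^bsub>C\<^esub> (g \<oplus>\<^bsub>C\<^esub> h) = (f \<cdot>\<^bsub>C\<^esub> g) \<oplus>\<^bsub>C\<^esub> (f \<cdot>\<^bsub>C\<^esub> h)) \<and>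
        f \<cdot>\<^bsub>C\<^esub> \<zero>\<^bsub>C\<^esub> X (Dom C f) = \<zero>\<^bsub>C\<^esub> X (Cod C f))"

locale cartesian_left_additive_category = left_additive_category +
  assumes One_Obj: "\<one> \<in> Obj C"
    and One_terminal: "A \<in> Obj C \<Longrightarrow> \<exists>!f. f \<in> Hom C A \<one>"
    and Prod_Obj: "A \<in> Obj C \<Longrightarrow> B \<in> Obj C \<Longrightarrow> A \<otimes> B \<in> Obj C"
    and Proj1_Hom: "A \<in> Obj C \<Longrightarrow> B \<in> Obj C \<Longrightarrow> \<pi>\<^sub>1 A B \<in> Hom C (A \<otimes> B) A"
    and Proj2_Hom: "A \<in> Obj C \<Longrightarrow> B \<in> Obj C \<Longrightarrow> \<pi>\<^sub>2 A B \<in> Hom C (A \<otimes> B) B"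
    and Pairing_Hom: "f \<in> Hom C X A \<Longrightarrow> g \<in> Hom C X B \<Longrightarrow> \<llangle>f, g\<rrangle> \<in> Hom C X (A \<otimes> B)"
    and Proj1_Pairing: "f \<in> Hom C X A \<Longrightarrow> g \<in> Hom C X B \<Longrightarrow> \<pi>\<^sub>1 A B \<cdot> \<llangle>f, g\<rrangle> = f"
    and Proj2_Pairing: "f \<in> Hom C X A \<Longrightarrow> g \<in> Hom C X B \<Longrightarrow> \<pi>\<^sub>2 A B \<cdot> \<llangle>f, g\<rrangle> = g"
    and Pairing_unique: "A \<in> Obj C \<Longrightarrow> B \<in> Obj C \<Longrightarrow> h \<in> Hom C X (A \<otimes> B)
      \<Longrightarrow> \<llangle>\<pi>\<^sub>1 A B \<cdot> h, \<pi>\<^sub>2 A B \<cdot> h\<rrangle> = h"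
    and Proj1_additive: "A \<in> Obj C \<Longrightarrow> B \<in> Obj C \<Longrightarrow> additive_arr C (\<pi>\<^sub>1 A B)"
    and Proj2_additive: "A \<in> Obj C \<Longrightarrow> B \<in> Obj C \<Longrightarrow> additive_arr C (\<pi>\<^sub>2 A B)"
    and Pairing_additive: "f \<in> Hom C X A \<Longrightarrow> g \<in> Hom C X B \<Longrightarrow> additive_arr C f \<Longrightarrow> additive_arr C g
      \<Longrightarrow> additive_arr C \<llangle>f, g\<rrangle>"

locale cartesian_differential_category = cartesian_left_additive_category +
  assumes Diff_Hom: "f \<in> Hom C A B \<Longrightarrow> \<D> f \<in> Hom C (A \<otimes> A) B"
    and D1_Add: "f \<in> Hom C A B \<Longrightarrow> g \<in> Hom C A B \<Longrightarrow> \<D> (f \<oplus> g) = \<D> f \<oplus> \<D> g"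
    and D1_Zero: "A \<in> Obj C \<Longrightarrow> B \<in> Obj C \<Longrightarrow> \<D> (\<zero> A B) = \<zero> (A \<otimes> A) B"
    and D2_Add: "f \<in> Hom C A B \<Longrightarrow> h \<in> Hom C X A \<Longrightarrow> k \<in> Hom C X A \<Longrightarrow> v \<in> Hom C X A
      \<Longrightarrow> \<D> f \<cdot> \<llangle>h \<oplus> k, v\<rrangle> = (\<D> f \<cdot> \<llangle>h, v\<rrangle>) \<oplus> (\<D> f \<cdot> \<llangle>k, v\<rrangle>)"
    and D2_Zero: "f \<in> Hom C A B \<Longrightarrow> v \<in> Hom C X A \<Longrightarrow> \<D> f \<cdot> \<llangle>\<zero> X A, v\<rrangle> = \<zero> X B"
    and D3_Ident: "A \<in> Obj C \<Longrightarrow> \<D> (\<I> A) = \<pi>\<^sub>1 A A"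
    and D3_Proj1: "A \<in> Obj C \<Longrightarrow> B \<in> Obj C
      \<Longrightarrow> \<D> (\<pi>\<^sub>1 A B) = \<pi>\<^sub>1 A B \<cdot> \<pi>\<^sub>1 (A \<otimes> B) (A \<otimes> B)"
    and D3_Proj2: "A \<in> Obj C \<Longrightarrow> B \<in> Obj C
      \<Longrightarrow> \<D> (\<pi>\<^sub>2 A B) = \<pi>\<^sub>2 A B \<cdot> \<pi>\<^sub>1 (A \<otimes> B) (A \<otimes> B)"
    and D4: "f \<in> Hom C X A \<Longrightarrow> g \<in> Hom C X B \<Longrightarrow> \<D> \<llangle>f, g\<rrangle> = \<llangle>\<D> f, \<D> g\<rrangle>"
    and D5: "g \<in> Hom C A B \<Longrightarrow> f \<in> Hom C B E
      \<Longrightarrow> \<D> (f \<cdot> g) = \<D> f \<cdot> \<llangle>\<D> g, g \<cdot> \<pi>\<^sub>2 A A\<rrangle>"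
    and D6: "f \<in> Hom C A B \<Longrightarrow> g \<in> Hom C X A \<Longrightarrow> h \<in> Hom C X A \<Longrightarrow> k \<in> Hom C X A
      \<Longrightarrow> \<D> (\<D> f) \<cdot> \<llangle>\<llangle>g, \<zero> X A\<rrangle>, \<llangle>h, k\<rrangle>\<rrangle> = \<D> f \<cdot> \<llangle>g, k\<rrangle>"
    and D7: "f \<in> Hom C A B \<Longrightarrow> g \<in> Hom C X A \<Longrightarrow> h \<in> Hom C X A \<Longrightarrow> k \<in> Hom C X A
      \<Longrightarrow> \<D> (\<D> f) \<cdot> \<llangle>\<llangle>\<zero> X A, h\<rrangle>, \<llangle>g, k\<rrangle>\<rrangle>
        = \<D> (\<D> f) \<cdot> \<llangle>\<llangle>\<zero> X A, g\<rrangle>, \<llangle>h, k\<rrangle>\<rrangle>"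

definition Cross :: "('o, 'm, 'x) ccdc_scheme \<Rightarrow> 'm \<Rightarrow> 'm \<Rightarrow> 'm" where
  "Cross C f g = \<llangle>f \<cdot>\<^bsub>C\<^esub> \<pi>\<^sub>1\<^bsub>C\<^esub> (Dom C f) (Dom C g), g \<cdot>\<^bsub>C\<^esub> \<pi>\<^sub>2\<^bsub>C\<^esub> (Dom C f) (Dom C g)\<rrangle>\<^bsub>C\<^esub>"

text \<open>\<open>\<Lambda>\<^sup>-\<close> for \<open>h : X \<rightarrow> A \<Rrightarrow> B\<close>.\<close>

definition Uncurry :: "('o, 'm, 'x) ccdc_scheme \<Rightarrow> 'o \<Rightarrow> 'o \<Rightarrow> 'm \<Rightarrow> 'm" where
  "Uncurry C A B h = \<E>\<^bsub>C\<^esub> A B \<cdot>\<^bsub>C\<^esub> Cross C h (\<I>\<^bsub>C\<^esub> A)"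

locale cartesian_closed_differential_category = cartesian_differential_category +
  assumes Exp_Obj: "A \<in> Obj C \<Longrightarrow> B \<in> Obj C \<Longrightarrow> A \<Rrightarrow> B \<in> Obj C"
    and Eval_Hom: "A \<in> Obj C \<Longrightarrow> B \<in> Obj C \<Longrightarrow> \<E> A B \<in> Hom C ((A \<Rrightarrow> B) \<otimes> A) B"
    and Curry_Hom: "X \<in> Obj C \<Longrightarrow> A \<in> Obj C \<Longrightarrow> f \<in> Hom C (X \<otimes> A) B
      \<Longrightarrow> \<Lambda> X A f \<in> Hom C X (A \<Rrightarrow> B)"
    and Uncurry_Curry: "X \<in> Obj C \<Longrightarrow> A \<in> Obj C \<Longrightarrow> f \<in> Hom C (X \<otimes> A) B
      \<Longrightarrow> Uncurry C A B (\<Lambda> X A f) = f"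
    and Curry_Uncurry: "A \<in> Obj C \<Longrightarrow> B \<in> Obj C \<Longrightarrow> h \<in> Hom C X (A \<Rrightarrow> B)
      \<Longrightarrow> \<Lambda> X A (Uncurry C A B h) = h"
    and Curry_Add: "X \<in> Obj C \<Longrightarrow> A \<in> Obj C \<Longrightarrow> f \<in> Hom C (X \<otimes> A) B \<Longrightarrow> g \<in> Hom C (X \<otimes> A) B
      \<Longrightarrow> \<Lambda> X A (f \<oplus> g) = \<Lambda> X A f \<oplus> \<Lambda> X A g"
    and Curry_Zero: "X \<in> Obj C \<Longrightarrow> A \<in> Obj C \<Longrightarrow> B \<in> Obj C
      \<Longrightarrow> \<Lambda> X A (\<zero> (X \<otimes> A) B) = \<zero> X (A \<Rrightarrow> B)"
    and Diff_Curry: "X \<in> Obj C \<Longrightarrow> A \<in> Obj C \<Longrightarrow> f \<in> Hom C (X \<otimes> A) B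
      \<Longrightarrow> \<D> (\<Lambda> X A f)
        = \<Lambda> (X \<otimes> X) A (\<D> f \<cdot> \<llangle>Cross C (\<pi>\<^sub>1 X X) (\<zero> A A), Cross C (\<pi>\<^sub>2 X X) (\<I> A)\<rrangle>)"

definition linear_arr :: "('o, 'm, 'x) ccdc_scheme \<Rightarrow> 'm \<Rightarrow> bool" where
  "linear_arr C f \<longleftrightarrow> \<D>\<^bsub>C\<^esub> f = f \<cdot>\<^bsub>C\<^esub> \<pi>\<^sub>1\<^bsub>C\<^esub> (Dom C f) (Dom C f)"

locale linear_reflexive_object = cartesian_closed_differential_category +
  fixes U :: 'a and \<A> \<L> :: 'b
  assumes U_Obj: "U \<in> Obj C"
    and A_Hom: "\<A> \<in> Hom C U (U \<Rrightarrow> U)"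
    and L_Hom: "\<L> \<in> Hom C (U \<Rrightarrow> U) U"
    and A_L: "\<A> \<cdot> \<L> = \<I> (U \<Rrightarrow> U)"
    and A_linear: "linear_arr C \<A>"
    and L_linear: "linear_arr C \<L>"

section \<open>Interpretation\<close>

text \<open>\<open>f \<star> g\<close> for \<open>f : X \<otimes> A \<rightarrow> B\<close> and \<open>g : X \<rightarrow> A\<close>.\<close>

definition Star :: "('o, 'm, 'x) ccdc_scheme \<Rightarrow> 'o \<Rightarrow> 'o \<Rightarrow> 'm \<Rightarrow> 'm \<Rightarrow> 'm" where
  "Star C X A f g =
     \<D>\<^bsub>C\<^esub> f \<cdot>\<^bsub>C\<^esub> \<llangle>\<llangle>\<zero>\<^bsub>C\<^esub> (X \<otimes>\<^bsub>C\<^esub> A) X, g \<cdot>\<^bsub>C\<^esub> \<pi>\<^sub>1\<^bsub>C\<^esub> X A\<rrangle>\<^bsub>C\<^esub>, \<I>\<^bsub>C\<^esub> (X \<otimes>\<^bsub>C\<^esub> A)\<rrangle>\<^bsub>C\<^esub>"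

text \<open>
  A sequence of variables is a list with its last variable at the head: the extension of a
  sequence \<open>xs\<close> by \<open>y\<close> is \<open>y # xs\<close>. A repeated variable denotes its most recent occurrence, so
  \<open>Lam z s\<close> can be interpreted in \<open>xs\<close> without first renaming a \<open>z\<close> that already occurs in \<open>xs\<close>.
\<close>

primrec Ctx :: "('o, 'm, 'x) ccdc_scheme \<Rightarrow> 'o \<Rightarrow> var list \<Rightarrow> 'o" where
  "Ctx C U [] = \<one>\<^bsub>C\<^esub>"
| "Ctx C U (x # xs) = Ctx C U xs \<otimes>\<^bsub>C\<^esub> U"

primrec proj :: "('o, 'm, 'x) ccdc_scheme \<Rightarrow> 'o \<Rightarrow> var list \<Rightarrow> var \<Rightarrow> 'm" where
  "proj C U [] x = undefined"
| "proj C U (z # xs) x =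
     (if x = z then \<pi>\<^sub>2\<^bsub>C\<^esub> (Ctx C U xs) U else proj C U xs x \<cdot>\<^bsub>C\<^esub> \<pi>\<^sub>1\<^bsub>C\<^esub> (Ctx C U xs) U)"

definition Hom_sum :: "('o, 'm, 'x) ccdc_scheme \<Rightarrow> 'o \<Rightarrow> 'o \<Rightarrow> 'm list \<Rightarrow> 'm" where
  "Hom_sum C A B fs = foldr (Add C) fs (\<zero>\<^bsub>C\<^esub> A B)"

primrec simple_interp ::
  "('o, 'm, 'x) ccdc_scheme \<Rightarrow> 'o \<Rightarrow> 'm \<Rightarrow> 'm \<Rightarrow> var simple \<Rightarrow> var list \<Rightarrow> 'm" where
  "simple_interp C U \<A> \<L> (Var x) xs = proj C U xs x"
| "simple_interp C U \<A> \<L> (Lam z s) xs =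
     \<L> \<cdot>\<^bsub>C\<^esub> \<Lambda>\<^bsub>C\<^esub> (Ctx C U xs) U (simple_interp C U \<A> \<L> s (z # xs))"
| "simple_interp C U \<A> \<L> (App s T) xs =
     \<E>\<^bsub>C\<^esub> U U \<cdot>\<^bsub>C\<^esub> \<llangle>\<A> \<cdot>\<^bsub>C\<^esub> simple_interp C U \<A> \<L> s xs,
       Hom_sum C (Ctx C U xs) U (map (\<lambda>t. simple_interp C U \<A> \<L> t xs) T)\<rrangle>\<^bsub>C\<^esub>"
| "simple_interp C U \<A> \<L> (Lin s t) xs =
     \<L> \<cdot>\<^bsub>C\<^esub> \<Lambda>\<^bsub>C\<^esub> (Ctx C U xs) U
       (Star C (Ctx C U xs) U (Uncurry C U U (\<A> \<cdot>\<^bsub>C\<^esub> simple_interp C U \<A> \<L> s xs))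
         (simple_interp C U \<A> \<L> t xs))"

definition raw_interp ::
  "('o, 'm, 'x) ccdc_scheme \<Rightarrow> 'o \<Rightarrow> 'm \<Rightarrow> 'm \<Rightarrow> var list \<Rightarrow> raw \<Rightarrow> 'm" where
  "raw_interp C U \<A> \<L> xs S = Hom_sum C (Ctx C U xs) U (map (\<lambda>s. simple_interp C U \<A> \<L> s xs) S)"

text \<open>
  The choice of representative is immaterial for adequate sequences: see \<open>interp_abs\<close> below.
\<close>

definition interp ::
  "('o, 'm, 'x) ccdc_scheme \<Rightarrow> 'o \<Rightarrow> 'm \<Rightarrow> 'm \<Rightarrow> var list \<Rightarrow> dterm \<Rightarrow> 'm" where
  "interp C U \<A> \<L> xs S = raw_interp C U \<A> \<L> xs (rep_dterm S)"

section \<open>Independence of the representative\<close>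

context category
begin

lemmas Obj_simps [simp] = Dom_Obj Cod_Obj

lemma Ident_simps [simp]:
  "A \<in> Obj C \<Longrightarrow> \<I> A \<in> Arr C" "A \<in> Obj C \<Longrightarrow> Dom C (\<I> A) = A" "A \<in> Obj C \<Longrightarrow> Cod C (\<I> A) = A"
  using Ident_Hom by (auto simp: Hom_def)

lemma Comp_simps [simp]:
  assumes "f \<in> Arr C" "g \<in> Arr C" "Dom C g = Cod C f"
  shows "g \<cdot> f \<in> Arr C" "Dom C (g \<cdot> f) = Dom C f" "Cod C (g \<cdot> f) = Cod C g"
  using Comp_Hom[of f "Dom C f" "Cod C f" g "Cod C g"] assms by (auto simp: Hom_def)

lemma Comp_assoc' [simp]:
  "f \<in> Arr C \<Longrightarrow> g \<in> Arr C \<Longrightarrow> h \<in> Arr C \<Longrightarrow> Dom C g = Cod C f \<Longrightarrow> Dom C h = Cod C g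
    \<Longrightarrow> (h \<cdot> g) \<cdot> f = h \<cdot> (g \<cdot> f)"
  by (rule Comp_assoc) (auto simp: Hom_def)

lemma Ident_left' [simp]: "f \<in> Arr C \<Longrightarrow> B = Cod C f \<Longrightarrow> \<I> B \<cdot> f = f"
  by (rule Ident_left) (auto simp: Hom_def)

lemma Ident_right' [simp]: "f \<in> Arr C \<Longrightarrow> A = Dom C f \<Longrightarrow> f \<cdot> \<I> A = f"
  by (rule Ident_right) (auto simp: Hom_def)

end

context left_additive_category
begin

lemma Zero_simps [simp]:
  assumes "A \<in> Obj C" "B \<in> Obj C"
  shows "\<zero> A B \<in> Arr C" "Dom C (\<zero> A B) = A" "Cod C (\<zero> A B) = B"
  using Zero_Hom assms by (auto simp: Hom_def)

lemma Add_simps [simp]: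
  assumes "f \<in> Arr C" "g \<in> Arr C" "Dom C f = Dom C g" "Cod C f = Cod C g"
  shows "f \<oplus> g \<in> Arr C" "Dom C (f \<oplus> g) = Dom C g" "Cod C (f \<oplus> g) = Cod C g"
  using Add_Hom[of f "Dom C f" "Cod C f" g] assms by (auto simp: Hom_def)

lemma Zero_Comp' [simp]:
  "f \<in> Arr C \<Longrightarrow> E \<in> Obj C \<Longrightarrow> B = Cod C f \<Longrightarrow> \<zero> B E \<cdot> f = \<zero> (Dom C f) E"
  by (rule Zero_Comp) (auto simp: Hom_def)

lemma Add_Comp' [simp]:
  "f \<in> Arr C \<Longrightarrow> g \<in> Arr C \<Longrightarrow> h \<in> Arr C \<Longrightarrow> Dom C g = Cod C f \<Longrightarrow> Dom C h = Cod C f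
    \<Longrightarrow> Cod C g = Cod C h \<Longrightarrow> (g \<oplus> h) \<cdot> f = (g \<cdot> f) \<oplus> (h \<cdot> f)"
  by (rule Add_Comp) (auto simp: Hom_def)

end

context cartesian_left_additive_category
begin

lemmas One_Prod_Obj [simp] = One_Obj Prod_Obj

lemma Proj_simps [simp]:
  assumes "A \<in> Obj C" "B \<in> Obj C"
  shows "\<pi>\<^sub>1 A B \<in> Arr C" "Dom C (\<pi>\<^sub>1 A B) = A \<otimes> B" "Cod C (\<pi>\<^sub>1 A B) = A"
    "\<pi>\<^sub>2 A B \<in> Arr C" "Dom C (\<pi>\<^sub>2 A B) = A \<otimes> B" "Cod C (\<pi>\<^sub>2 A B) = B"
  using Proj1_Hom Proj2_Hom assms by (auto simp: Hom_def)

lemma Pairing_simps [simp]: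
  assumes "f \<in> Arr C" "g \<in> Arr C" "Dom C f = Dom C g"
  shows "\<llangle>f, g\<rrangle> \<in> Arr C" "Dom C \<llangle>f, g\<rrangle> = Dom C g" "Cod C \<llangle>f, g\<rrangle> = Cod C f \<otimes> Cod C g"
  using Pairing_Hom[of f "Dom C f" "Cod C f" g "Cod C g"] assms by (auto simp: Hom_def)

lemma Proj_Pairing [simp]:
  assumes "f \<in> Arr C" "g \<in> Arr C" "Dom C f = Dom C g" "A = Cod C f" "B = Cod C g"
  shows "\<pi>\<^sub>1 A B \<cdot> \<llangle>f, g\<rrangle> = f" "\<pi>\<^sub>2 A B \<cdot> \<llangle>f, g\<rrangle> = g"
  using assms Proj1_Pairing[of f "Dom C f" A g B] Proj2_Pairing[of f "Dom C f" A g B]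
  by (auto simp: Hom_def)

lemma Pairing_eqI:
  assumes "h \<in> Arr C" "k \<in> Arr C" "Dom C h = Dom C k" "Cod C h = A \<otimes> B" "Cod C k = A \<otimes> B"
    "A \<in> Obj C" "B \<in> Obj C"
    "\<pi>\<^sub>1 A B \<cdot> h = \<pi>\<^sub>1 A B \<cdot> k" "\<pi>\<^sub>2 A B \<cdot> h = \<pi>\<^sub>2 A B \<cdot> k"
  shows "h = k"
proof -
  have "h = \<llangle>\<pi>\<^sub>1 A B \<cdot> h, \<pi>\<^sub>2 A B \<cdot> h\<rrangle>"
    by (rule Pairing_unique[symmetric]) (use assms(1-7) in \<open>auto simp: Hom_def\<close>)
  also have "\<dots> = \<llangle>\<pi>\<^sub>1 A B \<cdot> k, \<pi>\<^sub>2 A B \<cdot> k\<rrangle>"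
    by (simp only: assms(8,9))
  also have "\<dots> = k"
    by (rule Pairing_unique) (use assms(1-7) in \<open>auto simp: Hom_def\<close>)
  finally show ?thesis .
qed

lemma Pairing_Comp [simp]:
  assumes "f \<in> Arr C" "g \<in> Arr C" "h \<in> Arr C" "Dom C f = Cod C h" "Dom C g = Cod C h"
  shows "\<llangle>f, g\<rrangle> \<cdot> h = \<llangle>f \<cdot> h, g \<cdot> h\<rrangle>"
  by (rule Pairing_eqI[of _ _ "Cod C f" "Cod C g"])
    (use assms in \<open>simp_all flip: Comp_assoc'\<close>)

lemma Pairing_Proj [simp]:
  assumes "A \<in> Obj C" "B \<in> Obj C"
  shows "\<llangle>\<pi>\<^sub>1 A B, \<pi>\<^sub>2 A B\<rrangle> = \<I> (A \<otimes> B)"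
  by (rule Pairing_eqI[of _ _ A B]) (use assms in simp_all)

lemma Pairing_Zero [simp]:
  assumes "A \<in> Obj C" "B \<in> Obj C" "X \<in> Obj C"
  shows "\<llangle>\<zero> X A, \<zero> X B\<rrangle> = \<zero> X (A \<otimes> B)"
proof (rule Pairing_eqI[of _ _ A B])
  show "\<pi>\<^sub>1 A B \<cdot> \<llangle>\<zero> X A, \<zero> X B\<rrangle> = \<pi>\<^sub>1 A B \<cdot> \<zero> X (A \<otimes> B)"
    using Proj1_additive[of A B] assms by (simp add: additive_arr_def)
  show "\<pi>\<^sub>2 A B \<cdot> \<llangle>\<zero> X A, \<zero> X B\<rrangle> = \<pi>\<^sub>2 A B \<cdot> \<zero> X (A \<otimes> B)"
    using Proj2_additive[of A B] assms by (simp add: additive_arr_def)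
qed (use assms in simp_all)

lemma Pairing_Add:
  assumes "f \<in> Hom C X A" "f' \<in> Hom C X A" "g \<in> Hom C X B" "g' \<in> Hom C X B"
  shows "\<llangle>f \<oplus> f', g \<oplus> g'\<rrangle> = \<llangle>f, g\<rrangle> \<oplus> \<llangle>f', g'\<rrangle>"
proof (rule Pairing_eqI[of _ _ A B])
  have *: "A \<in> Obj C" "B \<in> Obj C" "X \<in> Obj C" using assms by (auto simp: Hom_def)
  show "\<pi>\<^sub>1 A B \<cdot> \<llangle>f \<oplus> f', g \<oplus> g'\<rrangle> = \<pi>\<^sub>1 A B \<cdot> (\<llangle>f, g\<rrangle> \<oplus> \<llangle>f', g'\<rrangle>)"
    using Proj1_additive[OF *(1,2)] assms * by (auto simp: additive_arr_def Hom_def)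
  show "\<pi>\<^sub>2 A B \<cdot> \<llangle>f \<oplus> f', g \<oplus> g'\<rrangle> = \<pi>\<^sub>2 A B \<cdot> (\<llangle>f, g\<rrangle> \<oplus> \<llangle>f', g'\<rrangle>)"
    using Proj2_additive[OF *(1,2)] assms * by (auto simp: additive_arr_def Hom_def)
qed (use assms in \<open>auto simp: Hom_def\<close>)

lemma Cross_simps [simp]:
  assumes "f \<in> Arr C" "g \<in> Arr C"
  shows "Cross C f g \<in> Arr C" "Dom C (Cross C f g) = Dom C f \<otimes> Dom C g"
    "Cod C (Cross C f g) = Cod C f \<otimes> Cod C g"
  unfolding Cross_def using assms by simp_all

end

context cartesian_differential_category
begin

lemma Diff_simps [simp]:
  assumes "f \<in> Arr C"
  shows "\<D> f \<in> Arr C" "Dom C (\<D> f) = Dom C f \<otimes> Dom C f" "Cod C (\<D> f) = Cod C f"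
  using Diff_Hom[of f "Dom C f" "Cod C f"] assms by (auto simp: Hom_def)

lemmas D3 [simp] = D1_Zero D3_Ident D3_Proj1 D3_Proj2

lemma D2_Zero' [simp]:
  assumes "f \<in> Arr C" "v \<in> Arr C" "X = Dom C v" "Dom C f = Cod C v" "A = Dom C f"
  shows "\<D> f \<cdot> \<llangle>\<zero> X A, v\<rrangle> = \<zero> X (Cod C f)"
  using D2_Zero[of f A "Cod C f" v X] assms by (simp add: Hom_def)

lemma D4' [simp]: "f \<in> Arr C \<Longrightarrow> g \<in> Arr C \<Longrightarrow> Dom C f = Dom C g \<Longrightarrow> \<D> \<llangle>f, g\<rrangle> = \<llangle>\<D> f, \<D> g\<rrangle>"
  by (rule D4) (auto simp: Hom_def)

lemma D5' [simp]:
  "f \<in> Arr C \<Longrightarrow> g \<in> Arr C \<Longrightarrow> Dom C f = Cod C g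
    \<Longrightarrow> \<D> (f \<cdot> g) = \<D> f \<cdot> \<llangle>\<D> g, g \<cdot> \<pi>\<^sub>2 (Dom C g) (Dom C g)\<rrangle>"
  by (rule D5) (auto simp: Hom_def)

lemma Star_simps [simp]:
  assumes "f \<in> Arr C" "g \<in> Arr C" "Dom C f = X \<otimes> A" "Dom C g = X" "Cod C g = A"
  shows "Star C X A f g \<in> Arr C" "Dom C (Star C X A f g) = X \<otimes> A"
    "Cod C (Star C X A f g) = Cod C f"
proof -
  have "X \<in> Obj C" "A \<in> Obj C" using assms by auto
  then show "Star C X A f g \<in> Arr C" "Dom C (Star C X A f g) = X \<otimes> A"
    "Cod C (Star C X A f g) = Cod C f"
    unfolding Star_def using assms by simp_all
qed

lemma Star_Star:
  assumes "f \<in> Arr C" "g \<in> Arr C" "h \<in> Arr C" "Dom C f = X \<otimes> A"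
    "Dom C g = X" "Cod C g = A" "Dom C h = X" "Cod C h = A"
  shows "Star C X A (Star C X A f g) h
    = \<D> (\<D> f) \<cdot> \<llangle>\<llangle>\<zero> (X \<otimes> A) (X \<otimes> A), \<llangle>\<zero> (X \<otimes> A) X, h \<cdot> \<pi>\<^sub>1 X A\<rrangle>\<rrangle>,
        \<llangle>\<llangle>\<zero> (X \<otimes> A) X, g \<cdot> \<pi>\<^sub>1 X A\<rrangle>, \<I> (X \<otimes> A)\<rrangle>\<rrangle>"
proof -
  have *: "X \<in> Obj C" "A \<in> Obj C" using assms by auto
  show ?thesis
    unfolding Star_def using assms * by simp
qed

lemma Star_commute:
  assumes "f \<in> Arr C" "g \<in> Arr C" "h \<in> Arr C" "Dom C f = X \<otimes> A"
    "Dom C g = X" "Cod C g = A" "Dom C h = X" "Cod C h = A"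
  shows "Star C X A (Star C X A f g) h = Star C X A (Star C X A f h) g"
proof -
  have *: "X \<in> Obj C" "A \<in> Obj C" using assms by auto
  show ?thesis
    using assms * by (simp add: Star_Star) (rule D7[of _ "X \<otimes> A" "Cod C f"], auto simp: Hom_def)
qed

end

context cartesian_closed_differential_category
begin

lemma Exp_simps [simp]:
  assumes "A \<in> Obj C" "B \<in> Obj C"
  shows "A \<Rrightarrow> B \<in> Obj C" "\<E> A B \<in> Arr C" "Dom C (\<E> A B) = (A \<Rrightarrow> B) \<otimes> A" "Cod C (\<E> A B) = B"
  using Exp_Obj Eval_Hom assms by (auto simp: Hom_def)

lemma Curry_simps [simp]:
  assumes "f \<in> Arr C" "Dom C f = X \<otimes> A" "X \<in> Obj C" "A \<in> Obj C"
  shows "\<Lambda> X A f \<in> Arr C" "Dom C (\<Lambda> X A f) = X" "Cod C (\<Lambda> X A f) = A \<Rrightarrow> Cod C f"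
  using Curry_Hom[of X A f "Cod C f"] assms by (auto simp: Hom_def)

lemma Uncurry_simps [simp]:
  assumes "h \<in> Arr C" "Cod C h = A \<Rrightarrow> B" "A \<in> Obj C" "B \<in> Obj C"
  shows "Uncurry C A B h \<in> Arr C" "Dom C (Uncurry C A B h) = Dom C h \<otimes> A" "Cod C (Uncurry C A B h) = B"
  unfolding Uncurry_def using assms by simp_all

lemma Uncurry_Curry' [simp]:
  "f \<in> Arr C \<Longrightarrow> Dom C f = X \<otimes> A \<Longrightarrow> X \<in> Obj C \<Longrightarrow> A \<in> Obj C \<Longrightarrow> B = Cod C f
    \<Longrightarrow> Uncurry C A B (\<Lambda> X A f) = f"
  by (rule Uncurry_Curry) (auto simp: Hom_def)

end

context linear_reflexive_object
begin

abbreviation "ctx \<equiv> Ctx C U"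
abbreviation "den \<equiv> simple_interp C U \<A> \<L>"

lemma AL_simps [simp]:
  "U \<in> Obj C" "\<A> \<in> Arr C" "Dom C \<A> = U" "Cod C \<A> = U \<Rrightarrow> U"
  "\<L> \<in> Arr C" "Dom C \<L> = U \<Rrightarrow> U" "Cod C \<L> = U"
  using U_Obj A_Hom L_Hom by (auto simp: Hom_def)

lemma A_L' [simp]: "f \<in> Arr C \<Longrightarrow> Cod C f = U \<Rrightarrow> U \<Longrightarrow> \<A> \<cdot> (\<L> \<cdot> f) = f"
  by (simp flip: Comp_assoc' add: A_L)

lemma Ctx_Obj [simp]: "ctx xs \<in> Obj C"
  by (induction xs) auto

lemma proj_simps [simp]:
  "x \<in> set xs \<Longrightarrow> proj C U xs x \<in> Arr C"
  "x \<in> set xs \<Longrightarrow> Dom C (proj C U xs x) = ctx xs"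
  "x \<in> set xs \<Longrightarrow> Cod C (proj C U xs x) = U"
  by (induction xs) auto

lemma Hom_sum_simps [simp]:
  assumes "set fs \<subseteq> Hom C A B" "A \<in> Obj C" "B \<in> Obj C"
  shows "Hom_sum C A B fs \<in> Arr C" "Dom C (Hom_sum C A B fs) = A" "Cod C (Hom_sum C A B fs) = B"
  using assms by (induction fs) (auto simp: Hom_sum_def Hom_def)

lemma den_Hom: "fv s \<subseteq> set xs \<Longrightarrow> den s xs \<in> Hom C (ctx xs) U"
proof (induction s arbitrary: xs)
  case (Lam z s)
  then have "den s (z # xs) \<in> Hom C (ctx (z # xs)) U"
    by (intro Lam.IH) auto
  then show ?case by (simp add: Hom_def)
next
  case (App s T)
  then have "set (map (\<lambda>t. den t xs) T) \<subseteq> Hom C (ctx xs) U" by force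
  moreover from App have "den s xs \<in> Hom C (ctx xs) U" by simp
  ultimately show ?case by (simp add: Hom_def[of _ _ U])
qed (simp_all add: Hom_def)

lemma den_simps [simp]:
  assumes "fv s \<subseteq> set xs"
  shows "den s xs \<in> Arr C" "Dom C (den s xs) = ctx xs" "Cod C (den s xs) = U"
  using den_Hom[OF assms] by (auto simp: Hom_def)

lemma Ctx_map: "ctx (map p xs) = ctx xs"
  by (induction xs) auto

lemma den_map_simple:
  "inj p \<Longrightarrow> fv s \<subseteq> set xs \<Longrightarrow> den (map_simple p s) (map p xs) = den s xs"
proof (induction s arbitrary: xs)
  case (Var x)
  then show ?case by (induction xs) (auto simp: inj_eq Ctx_map)
next
  case (Lam z s)
  then have "fv s \<subseteq> set (z # xs)" by auto
  from Lam.IH[OF Lam.prems(1) this] show ?case by (simp add: Ctx_map)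
next
  case (App s T)
  have "map (\<lambda>t. den (map_simple p t) (map p xs)) T = map (\<lambda>t. den t xs) T"
    using App.prems by (intro map_cong[OF HOL.refl] App.IH(2)) auto
  then show ?case using App by (simp add: comp_def Ctx_map del: map_eq_conv)
next
  case (Lin s t)
  then show ?case by (simp add: Ctx_map)
qed

lemma den_cong:
  "ctx xs = ctx ys \<Longrightarrow> (\<And>v. v \<in> fv s \<Longrightarrow> proj C U xs v = proj C U ys v) \<Longrightarrow> den s xs = den s ys"
proof (induction s arbitrary: xs ys)
  case (Lam z s)
  then have "den s (z # xs) = den s (z # ys)" by (intro Lam.IH) auto
  with Lam.prems show ?case by simp
next
  case (App s T)
  have "den s xs = den s ys" using App.prems by (intro App.IH(1)) auto
  moreover have "map (\<lambda>t. den t xs) T = map (\<lambda>t. den t ys) T"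
    using App.prems by (intro map_cong[OF HOL.refl] App.IH(2)) auto
  ultimately show ?case using App.prems by (simp only: simple_interp.simps)
next
  case (Lin s t)
  have "den s xs = den s ys" using Lin.prems by (intro Lin.IH(1)) auto
  moreover have "den t xs = den t ys" using Lin.prems by (intro Lin.IH(2)) auto
  ultimately show ?case using Lin.prems by (simp only: simple_interp.simps)
qed auto

lemma Hom_sum_perm:
  assumes "mset fs = mset gs" "set fs \<subseteq> Hom C A B" "A \<in> Obj C" "B \<in> Obj C"
  shows "Hom_sum C A B fs = Hom_sum C A B gs"
  using assms(1,2)
proof (induction fs arbitrary: gs)
  case Nil
  then show ?case by simp
next
  case (Cons f fs)
  then obtain gs1 gs2 where gs: "gs = gs1 @ f # gs2"
    by (metis list.set_intros(1) mset_eq_setD split_list)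
  with Cons have fs: "mset fs = mset (gs1 @ gs2)" by simp
  then have sub: "set (gs1 @ gs2) \<subseteq> Hom C A B"
    using Cons.prems by (metis insert_subset list.simps(15) mset_eq_setD)
  have f: "f \<in> Hom C A B" using Cons.prems by simp
  from sub have "Hom_sum C A B (gs1 @ f # gs2) = f \<oplus> Hom_sum C A B (gs1 @ gs2)"
  proof (induction gs1)
    case (Cons g gs1)
    let ?h = "Hom_sum C A B (gs1 @ gs2)"
    have h: "?h \<in> Hom C A B" and g: "g \<in> Hom C A B"
      using Cons.prems assms(3,4) by (auto simp: Hom_def[of C A B])
    have "g \<oplus> (f \<oplus> ?h) = f \<oplus> (g \<oplus> ?h)"
      using Add_assoc[OF g f h] Add_assoc[OF f g h] Add_commute[OF f g] by simp
    with Cons show ?case by (simp add: Hom_sum_def)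
  qed (simp add: Hom_sum_def)
  moreover have "Hom_sum C A B fs = Hom_sum C A B (gs1 @ gs2)"
    using fs Cons.prems by (intro Cons.IH) auto
  ultimately show ?case using gs by (simp add: Hom_sum_def)
qed

lemma Hom_sum_cong:
  assumes "rel_mset (\<lambda>s t. F s = F t \<and> F s \<in> Hom C A B) (mset S) (mset T)" "A \<in> Obj C" "B \<in> Obj C"
  shows "Hom_sum C A B (map F S) = Hom_sum C A B (map F T)"
proof (rule Hom_sum_perm)
  show "mset (map F S) = mset (map F T)"
    unfolding mset_map using assms(1) by (induction rule: rel_mset_ind) auto
  have "F ` set_mset (mset S) \<subseteq> Hom C A B"
    using assms(1) by (induction rule: rel_mset_ind) auto
  then show "set (map F S) \<subseteq> Hom C A B" by simp
qed (use assms in auto)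

lemma den_simple_eq: "simple_eq s t \<Longrightarrow> fv s \<subseteq> set xs \<Longrightarrow> den s xs = den t xs"
proof (induction arbitrary: xs rule: simple_eq.induct)
  case (sym s t)
  then show ?case using simple_eq_fv[OF sym.hyps] by simp
next
  case (trans s t u)
  then show ?case using simple_eq_fv[OF trans.hyps(1)] by simp
next
  case (alpha z x s)
  let ?p = "transpose x z"
  have inj: "inj ?p" by (rule inj_transpose)
  have "den (map_simple ?p s) (z # xs) = den s (map ?p (z # xs))"
  proof -
    have "fv s \<subseteq> set (map ?p (z # xs))"
    proof
      fix v assume "v \<in> fv s"
      then have "v = ?p z \<or> v = ?p v \<and> v \<in> set xs"
        using alpha by (cases "v = x") (auto simp: transpose_def)
      then show "v \<in> set (map ?p (z # xs))" by (auto intro: image_eqI)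
    qed
    from den_map_simple[OF inj this] show ?thesis by (simp add: comp_def)
  qed
  also have "\<dots> = den s (x # xs)"
  proof (rule den_cong)
    fix v assume v: "v \<in> fv s"
    have "proj C U (map ?p xs) v = proj C U xs v" if "v \<noteq> x"
    proof -
      have "v \<noteq> z" using v that alpha by auto
      then show ?thesis using that
      proof (induction xs)
        case (Cons a xs)
        then show ?case by (auto simp: transpose_def Ctx_map)
      qed simp
    qed
    then show "proj C U (map ?p (z # xs)) v = proj C U (x # xs) v" by (simp add: Ctx_map)
  qed (simp add: Ctx_map)
  finally show ?case by simp
next
  case (perm s t u)
  then show ?case
    by (simp add: Star_commute)
next
  case (Lam s s' x)
  then have "den s (x # xs) = den s' (x # xs)" by (intro Lam.IH) auto
  then show ?case by simp
next
  case (App s s' T T')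
  have fv: "fv t \<subseteq> set xs" if "t \<in># mset T" for t
    using App.prems that by auto
  have "rel_mset (\<lambda>t t'. den t xs = den t' xs \<and> den t xs \<in> Hom C (ctx xs) U) (mset T) (mset T')"
    using App(3) by (rule multiset.rel_mono_strong) (use fv den_Hom in blast)
  then have "Hom_sum C (ctx xs) U (map (\<lambda>t. den t xs) T) = Hom_sum C (ctx xs) U (map (\<lambda>t. den t xs) T')"
    by (rule Hom_sum_cong) simp_all
  moreover have "den s xs = den s' xs" using App.prems by (intro App.IH(1)) auto
  ultimately show ?case by simp
next
  case (Lin s s' t t')
  have "den s xs = den s' xs" using Lin.prems by (intro Lin.IH(1)) auto
  moreover have "den t xs = den t' xs" using Lin.prems by (intro Lin.IH(2)) auto
  ultimately show ?case by simp
next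
  case (refl s)
  show ?case by (rule HOL.refl)
qed

lemma interp_abs:
  assumes "fvs S \<subseteq> set xs"
  shows "interp C U \<A> \<L> xs (abs_dterm S) = raw_interp C U \<A> \<L> xs S"
proof -
  have fv: "fv s \<subseteq> set xs" if "s \<in># mset S" for s
    using assms that by (auto simp: fvs_def)
  have "raw_eq S (rep_dterm (abs_dterm S))"
    by (rule raw_eq_sym[OF Quotient3_rep_abs[OF Quotient3_dterm raw_eq_refl]])
  then have "rel_mset (\<lambda>s t. den s xs = den t xs \<and> den s xs \<in> Hom C (ctx xs) U)
      (mset S) (mset (rep_dterm (abs_dterm S)))"
    unfolding raw_eq_def by (rule multiset.rel_mono_strong) (use fv den_Hom den_simple_eq in blast)
  from Hom_sum_cong[OF this] show ?thesis
    by (simp add: interp_def raw_interp_def)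
qed

end

end

theory Submission
  imports Defs
begin

text \<open>
  The equation is the special case \<open>h = \<llangle>\<I>, \<lbrakk>T\<rbrakk>\<rrangle>\<close> of a statement about simultaneous
  substitutions: if an arrow \<open>h : U\<^sup>y\<^sup>s \<rightarrow> U\<^sup>x\<^sup>s\<close> satisfies \<open>\<pi>\<^sub>v \<cdot> h = \<lbrakk>\<rho> v\<rbrakk>\<close> for every free variable
  \<open>v\<close> of \<open>s\<close>, then \<open>\<lbrakk>s[\<rho>]\<rbrakk> = \<lbrakk>s\<rbrakk> \<cdot> h\<close>. This holds because each constructor is interpreted by an
  operation natural in the context. For \<open>\<star>\<close> this is the chain rule, where the derivative of \<open>h\<close>
  only ever occurs in direction \<open>0\<close> and so vanishes, so that \<open>h\<close> need not be linear. Since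
  substitution produces sums, the operations must also be additive in the positions of simple
  subterms, which is where linearity of \<open>\<A>\<close> and \<open>\<L>\<close> enters. Under a binder \<open>h\<close> becomes
  \<open>h \<times> \<I>\<close>, and the new hypothesis on \<open>\<rho>\<close> is weakening along \<open>\<pi>\<^sub>1\<close>, the renaming case of the same
  naturality.
\<close>

section \<open>Naturality and additivity of the semantic operations\<close>

context cartesian_differential_category
begin

text \<open>For linear \<open>f\<close>, \<open>f \<cdot> g\<close> equals
  \<open>\<D> f \<cdot> \<llangle>g, v\<rrangle>\<close> for every \<open>v\<close>, so D2,
  additivity of the derivative in its direction, becomes additivity of \<open>f\<close>. The free
  component \<open>v\<close> is taken to be \<open>g\<close>.\<close>

lemma linear_arr_Add:
  assumes "linear_arr C f" "f \<in> Arr C" "g \<in> Hom C X (Dom C f)" "h \<in> Hom C X (Dom C f)"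
  shows "f \<cdot> (g \<oplus> h) = (f \<cdot> g) \<oplus> (f \<cdot> h)"
  using D2_Add[of f "Dom C f" "Cod C f" g X h g] assms
  by (simp add: linear_arr_def Hom_def)

lemma linear_arr_Zero:
  assumes "linear_arr C f" "f \<in> Arr C" "X \<in> Obj C" "A = Dom C f"
  shows "f \<cdot> \<zero> X A = \<zero> X (Cod C f)"
  using D2_Zero[of f A "Cod C f" "\<zero> X A" X] assms
  \<comment> \<open>\<open>Pairing_Zero\<close> would merge the pair of zeros into one arrow, to
    which \<open>Proj_Pairing\<close> no longer applies; \<open>D2_Zero'\<close> could turn the
    instance of D2 into a trivial equation.\<close>
  by (simp add: linear_arr_def Hom_def del: D2_Zero' Pairing_Zero)

lemma Star_Add_left:
  assumes "f \<in> Hom C (X \<otimes> A) B" "f' \<in> Hom C (X \<otimes> A) B" "g \<in> Hom C X A"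
  shows "Star C X A (f \<oplus> f') g = Star C X A f g \<oplus> Star C X A f' g"
proof -
  have "X \<in> Obj C" "A \<in> Obj C" using assms by (auto simp: Hom_def)
  then show ?thesis
    using assms by (simp add: Star_def D1_Add[OF assms(1,2)]) (simp add: Hom_def)
qed

lemma Star_Zero_left:
  assumes "B \<in> Obj C" "g \<in> Hom C X A"
  shows "Star C X A (\<zero> (X \<otimes> A) B) g = \<zero> (X \<otimes> A) B"
proof -
  have "X \<in> Obj C" "A \<in> Obj C" using assms by (auto simp: Hom_def)
  then show ?thesis using assms by (simp add: Star_def Hom_def)
qed

lemma Star_Add_right:
  assumes "f \<in> Hom C (X \<otimes> A) B" "g \<in> Hom C X A" "g' \<in> Hom C X A"
  shows "Star C X A f (g \<oplus> g') = Star C X A f g \<oplus> Star C X A f g'"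
proof -
  have *: "X \<in> Obj C" "A \<in> Obj C" using assms by (auto simp: Hom_def)
  let ?z = "\<zero> (X \<otimes> A) X" and ?p = "\<pi>\<^sub>1 X A"
  \<comment> \<open>Doubling the zero makes both components sums, as \<open>Pairing_Add\<close>
    requires; the direction is then a sum of pairs, ready for D2.\<close>
  have "\<llangle>?z, (g \<oplus> g') \<cdot> ?p\<rrangle> = \<llangle>?z \<oplus> ?z, (g \<cdot> ?p) \<oplus> (g' \<cdot> ?p)\<rrangle>"
    using * assms by (simp add: Hom_def Zero_Add[OF Zero_Hom])
  also have "\<dots> = \<llangle>?z, g \<cdot> ?p\<rrangle> \<oplus> \<llangle>?z, g' \<cdot> ?p\<rrangle>"
    using * assms by (intro Pairing_Add) (auto simp: Hom_def)
  finally show ?thesis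
    using * assms by (simp add: Star_def) (rule D2_Add[OF assms(1)], auto simp: Hom_def)
qed

lemma Star_Zero_right:
  assumes "f \<in> Hom C (X \<otimes> A) B" "X \<in> Obj C" "A \<in> Obj C"
  shows "Star C X A f (\<zero> X A) = \<zero> (X \<otimes> A) B"
  using assms by (simp add: Star_def Hom_def)

text \<open>Both sides reduce to \<open>\<D> f\<close> at the point
  \<open>\<llangle>h \<cdot> \<pi>\<^sub>1, \<pi>\<^sub>2\<rrangle>\<close> in direction
  \<open>\<llangle>\<zero>, g \<cdot> h \<cdot> \<pi>\<^sub>1\<rrangle>\<close>. On the right, D5
  produces \<open>\<D> h\<close> in direction zero, which D2 removes.\<close>

lemma Star_Comp:
  assumes "f \<in> Hom C (X \<otimes> A) B" "g \<in> Hom C X A" "h \<in> Hom C Y X"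
  shows "Star C X A f g \<cdot> \<llangle>h \<cdot> \<pi>\<^sub>1 Y A, \<pi>\<^sub>2 Y A\<rrangle>
    = Star C Y A (f \<cdot> \<llangle>h \<cdot> \<pi>\<^sub>1 Y A, \<pi>\<^sub>2 Y A\<rrangle>) (g \<cdot> h)"
proof -
  have "X \<in> Obj C" "A \<in> Obj C" "Y \<in> Obj C" using assms by (auto simp: Hom_def)
  then show ?thesis using assms by (simp add: Star_def Hom_def)
qed

end

section \<open>Currying: naturality and additivity\<close>

context cartesian_closed_differential_category
begin

lemma Uncurry_Comp:
  assumes "f \<in> Hom C X (A \<Rrightarrow> B)" "h \<in> Hom C Y X" "A \<in> Obj C" "B \<in> Obj C"
  shows "Uncurry C A B (f \<cdot> h) = Uncurry C A B f \<cdot> \<llangle>h \<cdot> \<pi>\<^sub>1 Y A, \<pi>\<^sub>2 Y A\<rrangle>"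
proof -
  have "X \<in> Obj C" "Y \<in> Obj C" using assms by (auto simp: Hom_def)
  then show ?thesis using assms by (simp add: Uncurry_def Cross_def Hom_def)
qed

text \<open>Currying and uncurrying are mutually inverse, so it suffices to compare the uncurried
  arrows, and there \<open>Uncurry_Comp\<close> is a computation with products.\<close>

lemma Curry_Comp:
  assumes "f \<in> Hom C (X \<otimes> A) B" "h \<in> Hom C Y X" "A \<in> Obj C"
  shows "\<Lambda> X A f \<cdot> h = \<Lambda> Y A (f \<cdot> \<llangle>h \<cdot> \<pi>\<^sub>1 Y A, \<pi>\<^sub>2 Y A\<rrangle>)"
proof -
  have *: "X \<in> Obj C" "Y \<in> Obj C" "B \<in> Obj C" using assms by (auto simp: Hom_def)
  have "Uncurry C A B (\<Lambda> X A f \<cdot> h) = f \<cdot> \<llangle>h \<cdot> \<pi>\<^sub>1 Y A, \<pi>\<^sub>2 Y A\<rrangle>"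
    using * assms by (subst Uncurry_Comp[of _ X]) (auto simp: Hom_def)
  then show ?thesis
    using Curry_Uncurry[of A B "\<Lambda> X A f \<cdot> h" Y] * assms by (simp add: Hom_def)
qed

text \<open>The formula for \<open>Uncurry\<close> does not show this, as composing with evaluation
  on the left is not additive by axiom. It is carried over from \<open>Curry_Add\<close> along the
  bijection.\<close>

lemma Uncurry_Add:
  assumes "f \<in> Hom C X (A \<Rrightarrow> B)" "g \<in> Hom C X (A \<Rrightarrow> B)" "A \<in> Obj C" "B \<in> Obj C"
  shows "Uncurry C A B (f \<oplus> g) = Uncurry C A B f \<oplus> Uncurry C A B g"
proof -
  have "\<Lambda> X A (Uncurry C A B f \<oplus> Uncurry C A B g) = f \<oplus> g"
    using assms by (subst Curry_Add[of _ _ _ B]) (auto simp: Curry_Uncurry Hom_def)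
  moreover have "Uncurry C A B (\<Lambda> X A (Uncurry C A B f \<oplus> Uncurry C A B g))
      = Uncurry C A B f \<oplus> Uncurry C A B g"
    using assms by (intro Uncurry_Curry') (auto simp: Hom_def)
  ultimately show ?thesis by simp
qed

lemma Uncurry_Zero:
  assumes "X \<in> Obj C" "A \<in> Obj C" "B \<in> Obj C"
  shows "Uncurry C A B (\<zero> X (A \<Rrightarrow> B)) = \<zero> (X \<otimes> A) B"
  using Uncurry_Curry[of X A "\<zero> (X \<otimes> A) B" B] assms by (simp add: Curry_Zero Zero_Hom)

text \<open>Puts the function part on the left of a composition, where sums distribute by left
  additivity.\<close>

lemma Eval_Pairing:
  assumes "f \<in> Hom C X (A \<Rrightarrow> B)" "g \<in> Hom C X A" "B \<in> Obj C"
  shows "\<E> A B \<cdot> \<llangle>f, g\<rrangle> = Uncurry C A B f \<cdot> \<llangle>\<I> X, g\<rrangle>"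
proof -
  have "X \<in> Obj C" "A \<in> Obj C" using assms by (auto simp: Hom_def)
  then show ?thesis using assms by (simp add: Uncurry_def Cross_def Hom_def)
qed

end

section \<open>Operations of the reflexive object\<close>

context linear_reflexive_object
begin

text \<open>The semantic clauses for \<open>Lam\<close>, \<open>App\<close> and \<open>Lin\<close>
  as operations on arbitrary arrows, so that their laws also apply to interpretations of
  sums.\<close>

definition abstr :: "'a \<Rightarrow> 'b \<Rightarrow> 'b" where
  "abstr X f = \<L> \<cdot> \<Lambda> X U f"

definition app :: "'b \<Rightarrow> 'b \<Rightarrow> 'b" where
  "app f g = \<E> U U \<cdot> \<llangle>\<A> \<cdot> f, g\<rrangle>"

definition lin :: "'a \<Rightarrow> 'b \<Rightarrow> 'b \<Rightarrow> 'b" where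
  "lin X f g = abstr X (Star C X U (Uncurry C U U (\<A> \<cdot> f)) g)"

lemma A_Comp_Hom: "f \<in> Hom C X U \<Longrightarrow> \<A> \<cdot> f \<in> Hom C X (U \<Rrightarrow> U)"
  by (simp add: Hom_def)

lemma Uncurry_A_Hom: "f \<in> Hom C X U \<Longrightarrow> Uncurry C U U (\<A> \<cdot> f) \<in> Hom C (X \<otimes> U) U"
  by (auto simp: Hom_def)

lemma Star_Uncurry_A_Hom:
  "f \<in> Hom C X U \<Longrightarrow> g \<in> Hom C X U \<Longrightarrow> Star C X U (Uncurry C U U (\<A> \<cdot> f)) g \<in> Hom C (X \<otimes> U) U"
  by (auto simp: Hom_def)

lemma A_Add: "f \<in> Hom C X U \<Longrightarrow> g \<in> Hom C X U \<Longrightarrow> \<A> \<cdot> (f \<oplus> g) = (\<A> \<cdot> f) \<oplus> (\<A> \<cdot> g)"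
  by (rule linear_arr_Add[OF A_linear]) simp_all

lemma A_Zero: "X \<in> Obj C \<Longrightarrow> \<A> \<cdot> \<zero> X U = \<zero> X (U \<Rrightarrow> U)"
  using linear_arr_Zero[OF A_linear] by simp

lemma abstr_Add:
  assumes "X \<in> Obj C" "f \<in> Hom C (X \<otimes> U) U" "g \<in> Hom C (X \<otimes> U) U"
  shows "abstr X (f \<oplus> g) = abstr X f \<oplus> abstr X g"
proof -
  have "\<Lambda> X U (f \<oplus> g) = \<Lambda> X U f \<oplus> \<Lambda> X U g"
    by (rule Curry_Add[OF assms(1) U_Obj assms(2,3)])
  moreover have "\<L> \<cdot> (\<Lambda> X U f \<oplus> \<Lambda> X U g) = (\<L> \<cdot> \<Lambda> X U f) \<oplus> (\<L> \<cdot> \<Lambda> X U g)"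
    by (rule linear_arr_Add[OF L_linear, of _ X]) (use assms in \<open>auto simp: Hom_def\<close>)
  ultimately show ?thesis by (simp add: abstr_def)
qed

lemma abstr_Zero: "X \<in> Obj C \<Longrightarrow> abstr X (\<zero> (X \<otimes> U) U) = \<zero> X U"
  using linear_arr_Zero[OF L_linear] by (simp add: abstr_def Curry_Zero)

lemma abstr_Comp:
  assumes "f \<in> Hom C (X \<otimes> U) U" "h \<in> Hom C Y X"
  shows "abstr X f \<cdot> h = abstr Y (f \<cdot> \<llangle>h \<cdot> \<pi>\<^sub>1 Y U, \<pi>\<^sub>2 Y U\<rrangle>)"
proof -
  have "X \<in> Obj C" "Y \<in> Obj C" using assms by (auto simp: Hom_def)
  then have "abstr X f \<cdot> h = \<L> \<cdot> (\<Lambda> X U f \<cdot> h)"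
    using assms by (simp add: abstr_def Hom_def)
  then show ?thesis by (simp add: abstr_def Curry_Comp[OF assms U_Obj])
qed

text \<open>Only the function position is treated: an application keeps its argument as a whole sum.
  \<open>A_Add\<close> and \<open>Uncurry_Add\<close> distribute up to the composition given by
  \<open>Eval_Pairing\<close>.\<close>

lemma app_Add:
  assumes "f \<in> Hom C X U" "f' \<in> Hom C X U" "g \<in> Hom C X U"
  shows "app (f \<oplus> f') g = app f g \<oplus> app f' g"
proof -
  note * = A_Comp_Hom[OF assms(1)] A_Comp_Hom[OF assms(2)]
  have X: "X \<in> Obj C" using assms by (auto simp: Hom_def)
  have "app (f \<oplus> f') g = (Uncurry C U U (\<A> \<cdot> f) \<oplus> Uncurry C U U (\<A> \<cdot> f')) \<cdot> \<llangle>\<I> X, g\<rrangle>"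
    unfolding app_def A_Add[OF assms(1,2)] Eval_Pairing[OF Add_Hom[OF *] assms(3) U_Obj]
    by (simp add: Uncurry_Add[OF *])
  also have "\<dots> = (Uncurry C U U (\<A> \<cdot> f) \<cdot> \<llangle>\<I> X, g\<rrangle>) \<oplus> (Uncurry C U U (\<A> \<cdot> f') \<cdot> \<llangle>\<I> X, g\<rrangle>)"
    using Uncurry_A_Hom[OF assms(1)] Uncurry_A_Hom[OF assms(2)] assms(3) X
    by (intro Add_Comp') (auto simp: Hom_def)
  finally show ?thesis
    by (simp add: app_def Eval_Pairing[OF *(1) assms(3) U_Obj] Eval_Pairing[OF *(2) assms(3) U_Obj])
qed

lemma app_Zero:
  assumes "g \<in> Hom C X U"
  shows "app (\<zero> X U) g = \<zero> X U"
proof -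
  have X: "X \<in> Obj C" using assms by (auto simp: Hom_def)
  have "app (\<zero> X U) g = \<zero> (X \<otimes> U) U \<cdot> \<llangle>\<I> X, g\<rrangle>"
    using X by (simp add: app_def A_Zero Eval_Pairing[OF Zero_Hom assms] Uncurry_Zero)
  then show ?thesis using X assms by (simp add: Hom_def)
qed

lemma app_Comp:
  assumes "f \<in> Hom C X U" "g \<in> Hom C X U" "h \<in> Hom C Y X"
  shows "app f g \<cdot> h = app (f \<cdot> h) (g \<cdot> h)"
  using assms by (simp add: app_def Hom_def)

text \<open>A sum passes in turn through \<open>\<A>\<close>, \<open>Uncurry\<close>,
  \<open>Star\<close> and \<open>abstr\<close>, each additive here.\<close>

lemma lin_Add_left:
  assumes "f \<in> Hom C X U" "f' \<in> Hom C X U" "g \<in> Hom C X U"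
  shows "lin X (f \<oplus> f') g = lin X f g \<oplus> lin X f' g"
proof -
  have X: "X \<in> Obj C" using assms by (auto simp: Hom_def)
  show ?thesis
    unfolding lin_def A_Add[OF assms(1,2)]
      Uncurry_Add[OF A_Comp_Hom[OF assms(1)] A_Comp_Hom[OF assms(2)] U_Obj U_Obj]
      Star_Add_left[OF Uncurry_A_Hom[OF assms(1)] Uncurry_A_Hom[OF assms(2)] assms(3)]
    by (rule abstr_Add[OF X]) (auto intro: Star_Uncurry_A_Hom assms)
qed

lemma lin_Zero_left: "g \<in> Hom C X U \<Longrightarrow> lin X (\<zero> X U) g = \<zero> X U"
  using Dom_Obj[of g]
  by (auto simp: lin_def A_Zero Uncurry_Zero Star_Zero_left abstr_Zero Hom_def)

lemma lin_Add_right: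
  assumes "f \<in> Hom C X U" "g \<in> Hom C X U" "g' \<in> Hom C X U"
  shows "lin X f (g \<oplus> g') = lin X f g \<oplus> lin X f g'"
proof -
  have X: "X \<in> Obj C" using assms by (auto simp: Hom_def)
  show ?thesis
    unfolding lin_def Star_Add_right[OF Uncurry_A_Hom[OF assms(1)] assms(2,3)]
    by (rule abstr_Add[OF X]) (auto intro: Star_Uncurry_A_Hom assms)
qed

lemma lin_Zero_right:
  assumes "f \<in> Hom C X U"
  shows "lin X f (\<zero> X U) = \<zero> X U"
proof -
  have "X \<in> Obj C" using assms by (auto simp: Hom_def)
  then show ?thesis
    by (simp add: lin_def Star_Zero_right[OF Uncurry_A_Hom[OF assms]] abstr_Zero)
qed

lemma lin_Comp:
  assumes "f \<in> Hom C X U" "g \<in> Hom C X U" "h \<in> Hom C Y X"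
  shows "lin X f g \<cdot> h = lin Y (f \<cdot> h) (g \<cdot> h)"
proof -
  have "Uncurry C U U (\<A> \<cdot> (f \<cdot> h))
      = Uncurry C U U (\<A> \<cdot> f) \<cdot> \<llangle>h \<cdot> \<pi>\<^sub>1 Y U, \<pi>\<^sub>2 Y U\<rrangle>"
    using Uncurry_Comp[OF A_Comp_Hom[OF assms(1)] assms(3) U_Obj U_Obj] assms
    by (simp add: Hom_def)
  then show ?thesis
    by (simp add: lin_def abstr_Comp[OF Star_Uncurry_A_Hom[OF assms(1,2)] assms(3)]
      Star_Comp[OF Uncurry_A_Hom[OF assms(1)] assms(2,3)])
qed

section \<open>Interpretation of sums\<close>

abbreviation "dens \<equiv> raw_interp C U \<A> \<L>"

lemma dens_Nil [simp]: "dens xs [] = \<zero> (ctx xs) U"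
  by (simp add: raw_interp_def Hom_sum_def)

lemma dens_Cons [simp]: "dens xs (s # S) = den s xs \<oplus> dens xs S"
  by (simp add: raw_interp_def Hom_sum_def)

lemma fvs_simps [simp]:
  "fvs [] = {}" "fvs (s # S) = fv s \<union> fvs S" "fvs (S @ S') = fvs S \<union> fvs S'"
  by (auto simp: fvs_def)

lemma dens_Hom: "fvs S \<subseteq> set xs \<Longrightarrow> dens xs S \<in> Hom C (ctx xs) U"
  by (induction S) (auto intro: Zero_Hom Add_Hom den_Hom)

lemma dens_append:
  "fvs S \<subseteq> set xs \<Longrightarrow> fvs T \<subseteq> set xs \<Longrightarrow> dens xs (S @ T) = dens xs S \<oplus> dens xs T"
  by (induction S) (auto simp: Zero_Add[OF dens_Hom] Add_assoc[OF den_Hom dens_Hom dens_Hom])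

lemma dens_single [simp]: "fv s \<subseteq> set xs \<Longrightarrow> dens xs [s] = den s xs"
  using Add_commute[OF den_Hom Zero_Hom] Zero_Add[OF den_Hom] by simp

lemma den_Lam: "den (Lam z s) xs = abstr (ctx xs) (den s (z # xs))"
  by (simp add: abstr_def)

lemma den_App: "den (App s T) xs = app (den s xs) (dens xs T)"
  by (simp add: app_def raw_interp_def)

lemma den_Lin: "den (Lin s t) xs = lin (ctx xs) (den s xs) (den t xs)"
  by (simp add: lin_def abstr_def)

text \<open>Here and for \<open>app_sum\<close> and \<open>lin_sum\<close>, the syntactic
  distribution over sums is matched by semantic additivity, with the zero laws covering the empty
  sum.\<close>

lemma dens_lam_sum:
  "fvs S \<subseteq> set (z # xs) \<Longrightarrow> dens xs (lam_sum z S) = abstr (ctx xs) (dens (z # xs) S)"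
proof (induction S)
  case (Cons s S)
  have "den s (z # xs) \<in> Hom C (ctx xs \<otimes> U) U" "dens (z # xs) S \<in> Hom C (ctx xs \<otimes> U) U"
    using den_Hom[of s "z # xs"] dens_Hom[of S "z # xs"] Cons.prems by auto
  from abstr_Add[OF Ctx_Obj this] Cons show ?case
    by (simp add: lam_sum_def den_Lam del: simple_interp.simps)
qed (simp add: lam_sum_def abstr_Zero)

lemma dens_app_sum:
  "fvs S \<subseteq> set xs \<Longrightarrow> fvs T \<subseteq> set xs \<Longrightarrow> dens xs (app_sum S T) = app (dens xs S) (dens xs T)"
  by (induction S)
    (auto simp: app_sum_def den_App app_Zero[OF dens_Hom] app_Add[OF den_Hom dens_Hom dens_Hom]
      simp del: simple_interp.simps)

lemma dens_map_Lin:
  "fv s \<subseteq> set xs \<Longrightarrow> fvs T \<subseteq> set xs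
    \<Longrightarrow> dens xs (map (Lin s) T) = lin (ctx xs) (den s xs) (dens xs T)"
  by (induction T)
    (auto simp: den_Lin lin_Zero_right[OF den_Hom] lin_Add_right[OF den_Hom den_Hom dens_Hom]
      simp del: simple_interp.simps)

lemma fvs_lin_sum: "fvs (lin_sum S T) \<subseteq> fvs S \<union> fvs T"
  by (auto simp: fvs_def lin_sum_def)

lemma dens_lin_sum:
  "fvs S \<subseteq> set xs \<Longrightarrow> fvs T \<subseteq> set xs
    \<Longrightarrow> dens xs (lin_sum S T) = lin (ctx xs) (dens xs S) (dens xs T)"
proof (induction S)
  case Nil
  then show ?case by (simp add: lin_sum_def lin_Zero_left[OF dens_Hom])
next
  case (Cons s S)
  have "fvs (map (Lin s) T) \<subseteq> set xs"
    using Cons.prems by (auto simp: fvs_def)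
  moreover have "fvs (lin_sum S T) \<subseteq> set xs"
    using Cons.prems fvs_lin_sum[of S T] by auto
  \<comment> \<open>The double sum is listed row by row; \<open>map (Lin s) T\<close> is its first
    row.\<close>
  ultimately have "dens xs (lin_sum (s # S) T) = dens xs (map (Lin s) T) \<oplus> dens xs (lin_sum S T)"
    using dens_append by (simp add: lin_sum_def)
  then show ?case
    using Cons by (simp add: dens_map_Lin lin_Add_left[OF den_Hom dens_Hom dens_Hom])
qed

text \<open>Lifts a naturality statement from simple terms to sums: precomposition with any
  \<open>h\<close> preserves sums and zero. It serves both substitution and, with
  \<open>f t = [t]\<close>, renaming.\<close>

lemma dens_Comp_cong:
  assumes "h \<in> Hom C (ctx ys) (ctx xs)" "fvs T \<subseteq> set xs"
    and "\<And>t. t \<in> set T \<Longrightarrow> fvs (f t) \<subseteq> set ys"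
    and "\<And>t. t \<in> set T \<Longrightarrow> dens ys (f t) = den t xs \<cdot> h"
  shows "dens ys (concat (map f T)) = dens xs T \<cdot> h"
  using assms(2-4)
proof (induction T)
  case Nil
  then show ?case using Zero_Comp[OF assms(1) U_Obj] by simp
next
  case (Cons t T)
  have "fvs (concat (map f T)) \<subseteq> set ys"
    using Cons.prems(2) by (auto simp: fvs_def)
  moreover have "fvs (f t) \<subseteq> set ys" using Cons.prems(2) by simp
  ultimately show ?case
    using Cons by (simp add: dens_append Add_Comp[OF assms(1) den_Hom dens_Hom])
qed

section \<open>Weakening and substitution\<close>

lemma lift_Hom:
  assumes "h \<in> Hom C Y X"
  shows "\<llangle>h \<cdot> \<pi>\<^sub>1 Y U, \<pi>\<^sub>2 Y U\<rrangle> \<in> Hom C (Y \<otimes> U) (X \<otimes> U)"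
proof -
  have "X \<in> Obj C" "Y \<in> Obj C" using assms by (auto simp: Hom_def)
  with assms show ?thesis by (simp add: Hom_def)
qed

lemma proj_lift:
  assumes "h \<in> Hom C (ctx ys) (ctx xs)" "v \<in> set (z # xs)"
  shows "proj C U (z # xs) v \<cdot> \<llangle>h \<cdot> \<pi>\<^sub>1 (ctx ys) U, \<pi>\<^sub>2 (ctx ys) U\<rrangle>
    = (if v = z then \<pi>\<^sub>2 (ctx ys) U else (proj C U xs v \<cdot> h) \<cdot> \<pi>\<^sub>1 (ctx ys) U)"
  using assms by (auto simp: Hom_def)

text \<open>The term stays fixed and only the context changes. The projections are compared at free
  variables alone, so shadowed entries of \<open>xs\<close> and \<open>ys\<close> cause no
  conflict.\<close>

lemma den_rename:
  assumes "h \<in> Hom C (ctx ys) (ctx xs)" "fv s \<subseteq> set xs" "fv s \<subseteq> set ys"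
    and "\<And>v. v \<in> fv s \<Longrightarrow> proj C U xs v \<cdot> h = proj C U ys v"
  shows "den s ys = den s xs \<cdot> h"
  using assms
proof (induction s arbitrary: xs ys h)
  case (Var x)
  then show ?case by simp
next
  case (Lam z s)
  let ?h = "\<llangle>h \<cdot> \<pi>\<^sub>1 (ctx ys) U, \<pi>\<^sub>2 (ctx ys) U\<rrangle>"
  have fv: "fv s \<subseteq> set (z # xs)" using Lam.prems by auto
  have "den s (z # ys) = den s (z # xs) \<cdot> ?h"
  proof (rule Lam.IH)
    fix v assume "v \<in> fv s"
    with fv have "v \<in> set (z # xs)" by auto
    from proj_lift[OF Lam.prems(1) this] show "proj C U (z # xs) v \<cdot> ?h = proj C U (z # ys) v"
      using Lam.prems(4) \<open>v \<in> fv s\<close> by (auto simp del: Comp_assoc')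
  qed (use Lam.prems lift_Hom in auto)
  moreover have "den s (z # xs) \<in> Hom C (ctx xs \<otimes> U) U" using den_Hom[OF fv] by simp
  ultimately show ?case
    using Lam.prems(1) by (simp add: den_Lam abstr_Comp del: simple_interp.simps)
next
  case (App s T)
  have T: "fvs T \<subseteq> set xs" using App.prems by (auto simp: fvs_def)
  \<comment> \<open>Writing \<open>T\<close> as a concatenation of singletons makes it an instance
    of \<open>dens_Comp_cong\<close>.\<close>
  have "dens ys (concat (map (\<lambda>t. [t]) T)) = dens xs T \<cdot> h"
  proof (rule dens_Comp_cong[OF App.prems(1) T])
    fix t assume t: "t \<in> set T"
    show "fvs [t] \<subseteq> set ys" using t App.prems(3) by auto
    then show "dens ys [t] = den t xs \<cdot> h"
      using t App.prems by (subst dens_single, simp) (intro App.IH(2), auto)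
  qed
  moreover have "den s ys = den s xs \<cdot> h"
    using App.prems by (intro App.IH(1)) auto
  ultimately show ?case
    using App.prems(1,2) T
    by (simp add: den_App app_Comp[OF den_Hom dens_Hom] del: simple_interp.simps)
next
  case (Lin s t)
  have "den s ys = den s xs \<cdot> h" "den t ys = den t xs \<cdot> h"
    using Lin.prems by (auto intro!: Lin.IH)
  then show ?case
    using Lin.prems(1,2)
    by (simp add: den_Lin lin_Comp[OF den_Hom den_Hom] del: simple_interp.simps)
qed

text \<open>\<open>z\<close> may already occur in \<open>xs\<close>, where the new head would shadow
  it; \<open>z \<notin> fvs S\<close> keeps the projections used by \<open>S\<close> unchanged up to
  \<open>\<pi>\<^sub>1\<close>.\<close>

lemma dens_weaken:
  assumes "fvs S \<subseteq> set xs" "z \<notin> fvs S"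
  shows "dens (z # xs) S = dens xs S \<cdot> \<pi>\<^sub>1 (ctx xs) U"
proof -
  have p: "\<pi>\<^sub>1 (ctx xs) U \<in> Hom C (ctx (z # xs)) (ctx xs)"
    by (simp add: Hom_def)
  have "dens (z # xs) (concat (map (\<lambda>s. [s]) S)) = dens xs S \<cdot> \<pi>\<^sub>1 (ctx xs) U"
  proof (rule dens_Comp_cong[OF p assms(1)])
    fix s assume s: "s \<in> set S"
    then have fv: "fv s \<subseteq> set xs" "z \<notin> fv s" using assms by (auto simp: fvs_def)
    then show "fvs [s] \<subseteq> set (z # xs)" by auto
    then show "dens (z # xs) [s] = den s xs \<cdot> \<pi>\<^sub>1 (ctx xs) U"
      using fv p by (subst dens_single, simp) (intro den_rename, auto)
  qed
  then show ?thesis by simp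
qed

section \<open>Simultaneous substitution and its free variables\<close>

lemma fresh_notin: "finite X \<Longrightarrow> fresh X \<notin> X"
  unfolding fresh_def by (rule LeastI_ex) (rule ex_new_if_finite[OF infinite_UNIV_nat])

text \<open>Supplies the adequacy conditions of the lemmas on sums when they are applied to
  substituted terms.\<close>

lemma fvs_psubst: "fvs (psubst s \<rho>) \<subseteq> (\<Union>v\<in>fv s. fvs (\<rho> v))"
proof (induction s arbitrary: \<rho>)
  case (Lam z s)
  define z' where "z' = fresh (\<Union>v\<in>fv (Lam z s). fvs (\<rho> v))"
  have "fvs (psubst (Lam z s) \<rho>) = fvs (psubst s (\<rho>(z := [Var z']))) - {z'}"
    unfolding psubst.simps Let_def z'_def[symmetric] by (auto simp: lam_sum_def fvs_def)
  also have "\<dots> \<subseteq> (\<Union>v\<in>fv s. fvs ((\<rho>(z := [Var z'])) v)) - {z'}"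
    using Lam[of "\<rho>(z := [Var z'])"] by blast
  also have "\<dots> \<subseteq> (\<Union>v\<in>fv (Lam z s). fvs (\<rho> v))"
    by (auto split: if_splits)
  finally show ?case .
next
  case (App s T)
  have "fvs (psubst (App s T) \<rho>) \<subseteq> fvs (psubst s \<rho>) \<union> (\<Union>t\<in>set T. fvs (psubst t \<rho>))"
    by (auto simp: app_sum_def fvs_def)
  also have "\<dots> \<subseteq> (\<Union>v\<in>fv s. fvs (\<rho> v)) \<union> (\<Union>t\<in>set T. \<Union>v\<in>fv t. fvs (\<rho> v))"
    by (intro Un_mono UN_mono App.IH subset_refl)
  also have "\<dots> = (\<Union>v\<in>fv (App s T). fvs (\<rho> v))" by auto
  finally show ?case .
next
  case (Lin s t)
  show ?case
    using fvs_lin_sum[of "psubst s \<rho>" "psubst t \<rho>"] Lin[of \<rho>]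
    unfolding fv.simps psubst.simps by blast
qed simp

lemma dens_psubst:
  assumes "h \<in> Hom C (ctx ys) (ctx xs)" "fv s \<subseteq> set xs"
    and "\<And>v. v \<in> fv s \<Longrightarrow> fvs (\<rho> v) \<subseteq> set ys"
    and "\<And>v. v \<in> fv s \<Longrightarrow> proj C U xs v \<cdot> h = dens ys (\<rho> v)"
  shows "dens ys (psubst s \<rho>) = den s xs \<cdot> h"
  using assms
proof (induction s arbitrary: xs ys h \<rho>)
  case (Var x)
  then show ?case by simp
next
  case (Lam z s)
  define V where "V = (\<Union>v\<in>fv (Lam z s). fvs (\<rho> v))"
  define z' where "z' = fresh V"
  let ?h = "\<llangle>h \<cdot> \<pi>\<^sub>1 (ctx ys) U, \<pi>\<^sub>2 (ctx ys) U\<rrangle>" and ?\<rho> = "\<rho>(z := [Var z'])"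
  have "V \<subseteq> set ys" using Lam.prems(3) by (auto simp: V_def)
  then have "finite V" by (rule finite_subset) simp
  \<comment> \<open>\<open>z'\<close> avoids the substituted terms but may occur in
    \<open>ys\<close>; this is exactly the freshness that \<open>dens_weaken\<close> asks
    for.\<close>
  then have z': "z' \<notin> fvs (\<rho> v)" if "v \<in> fv (Lam z s)" for v
    using fresh_notin that unfolding z'_def V_def by blast
  have fv: "fv s \<subseteq> set (z # xs)" using Lam.prems by auto
  have sub: "fvs (?\<rho> v) \<subseteq> set (z' # ys)" if "v \<in> fv s" for v
    using Lam.prems(3)[of v] that by auto
  have "dens (z' # ys) (psubst s ?\<rho>) = den s (z # xs) \<cdot> ?h"
  proof (rule Lam.IH)
    fix v assume v: "v \<in> fv s"
    with fv have "v \<in> set (z # xs)" by auto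
    from proj_lift[OF Lam.prems(1) this]
    show "proj C U (z # xs) v \<cdot> ?h = dens (z' # ys) (?\<rho> v)"
      \<comment> \<open>At \<open>z\<close> both sides are the last projection; elsewhere the
        hypothesis is weakened along \<open>\<pi>\<^sub>1\<close>. Reassociation is switched off so
        that \<open>proj C U xs v \<cdot> h\<close> stays visible.\<close>
      using Lam.prems(3,4)[of v] z'[of v] v
      by (auto simp: dens_weaken simp del: Comp_assoc' dens_Cons)
  qed (use Lam.prems lift_Hom fv sub in auto)
  moreover have "fvs (psubst s ?\<rho>) \<subseteq> set (z' # ys)"
    using fvs_psubst[of s ?\<rho>] sub by blast
  moreover have "den s (z # xs) \<in> Hom C (ctx xs \<otimes> U) U" using den_Hom[OF fv] by simp
  ultimately show ?case
    using Lam.prems(1)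
    by (simp add: Let_def V_def[symmetric, simplified] z'_def[symmetric] den_Lam abstr_Comp
      dens_lam_sum del: simple_interp.simps)
next
  case (App s T)
  have T: "fvs T \<subseteq> set xs" using App.prems by (auto simp: fvs_def)
  have sub: "fvs (psubst t \<rho>) \<subseteq> set ys" if "t = s \<or> t \<in> set T" for t
  proof -
    have "fv t \<subseteq> fv (App s T)" using that by auto
    then show ?thesis using fvs_psubst[of t \<rho>] App.prems(3) by blast
  qed
  have "dens ys (concat (map (\<lambda>t. psubst t \<rho>) T)) = dens xs T \<cdot> h"
  proof (rule dens_Comp_cong[OF App.prems(1) T])
    fix t assume t: "t \<in> set T"
    show "fvs (psubst t \<rho>) \<subseteq> set ys" using sub t by simp
    show "dens ys (psubst t \<rho>) = den t xs \<cdot> h"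
      using t App.prems by (intro App.IH(2)) auto
  qed
  moreover have "dens ys (psubst s \<rho>) = den s xs \<cdot> h"
    using App.prems by (intro App.IH(1)) auto
  moreover have "fvs (concat (map (\<lambda>t. psubst t \<rho>) T)) \<subseteq> set ys"
    using sub by (auto simp: fvs_def)
  ultimately show ?case
    using App.prems(1,2) T sub
    by (simp add: den_App dens_app_sum app_Comp[OF den_Hom dens_Hom] del: simple_interp.simps)
next
  case (Lin s t)
  have "dens ys (psubst s \<rho>) = den s xs \<cdot> h" "dens ys (psubst t \<rho>) = den t xs \<cdot> h"
    using Lin.prems by (auto intro!: Lin.IH)
  moreover have "fvs (psubst s \<rho>) \<subseteq> set ys" "fvs (psubst t \<rho>) \<subseteq> set ys"
    using fvs_psubst[of s \<rho>] fvs_psubst[of t \<rho>] Lin.prems(3) unfolding fv.simps by blast+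
  ultimately show ?case
    using Lin.prems(1,2)
    by (simp add: den_Lin dens_lin_sum lin_Comp[OF den_Hom den_Hom] del: simple_interp.simps)
qed

text \<open>Composing with \<open>\<llangle>\<I>, \<lbrakk>T\<rbrakk>\<rrangle>\<close> sends the
  projection at \<open>y\<close> to the interpretation of \<open>T\<close> and each other one to the
  projection from \<open>xs\<close>. The first conclusion is the adequacy needed for
  \<open>interp_abs\<close>.\<close>

lemma raw_subst_dens:
  assumes "fvs S \<subseteq> set (y # xs)" "fvs T \<subseteq> set xs"
  shows "fvs (raw_subst S T y) \<subseteq> set xs"
    and "dens xs (raw_subst S T y) = dens (y # xs) S \<cdot> \<llangle>\<I> (ctx xs), dens xs T\<rrangle>"
proof -
  let ?\<rho> = "(\<lambda>v. [Var v])(y := T)"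
  have T: "dens xs T \<in> Hom C (ctx xs) U" by (rule dens_Hom[OF assms(2)])
  then have h: "\<llangle>\<I> (ctx xs), dens xs T\<rrangle> \<in> Hom C (ctx xs) (ctx (y # xs))"
    by (simp add: Hom_def)
  have fv: "fv s \<subseteq> set (y # xs)" if "s \<in> set S" for s
    using assms(1) that by (auto simp: fvs_def)
  have \<rho>: "fvs (?\<rho> v) \<subseteq> set xs" if "v \<in> set (y # xs)" for v
    using assms(2) that by auto
  have sub: "fvs (psubst s ?\<rho>) \<subseteq> set xs" if "s \<in> set S" for s
    using fvs_psubst[of s ?\<rho>] fv[OF that] \<rho> by blast
  then show "fvs (raw_subst S T y) \<subseteq> set xs"
    by (auto simp: raw_subst_def fvs_def)
  show "dens xs (raw_subst S T y) = dens (y # xs) S \<cdot> \<llangle>\<I> (ctx xs), dens xs T\<rrangle>"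
    unfolding raw_subst_def
  proof (rule dens_Comp_cong[OF h assms(1) sub])
    fix s assume s: "s \<in> set S"
    show "dens xs (psubst s ?\<rho>) = den s (y # xs) \<cdot> \<llangle>\<I> (ctx xs), dens xs T\<rrangle>"
    proof (rule dens_psubst[OF h fv[OF s]])
      fix v assume "v \<in> fv s"
      then have v: "v \<in> set (y # xs)" using fv[OF s] by blast
      then show "fvs (?\<rho> v) \<subseteq> set xs" by (rule \<rho>)
      show "proj C U (y # xs) v \<cdot> \<llangle>\<I> (ctx xs), dens xs T\<rrangle> = dens xs (?\<rho> v)"
        using v T by (auto simp: Hom_def simp del: dens_Cons)
    qed
  qed
qed

end

theorem theorem4p9:
  fixes C :: "('o, 'm, 'x) ccdc_scheme" (structure)
    and U :: 'o and \<A> \<L> :: 'm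
    and S T :: dterm and xs :: "var list" and y :: var
  assumes "linear_reflexive_object C U \<A> \<L>"
    and "distinct xs" and "y \<notin> set xs"
    and "adequate (y # xs) S" and "adequate xs T"
  shows "interp C U \<A> \<L> xs (subst S T y)
    = interp C U \<A> \<L> (y # xs) S \<cdot> \<llangle>\<I> (Ctx C U xs), interp C U \<A> \<L> xs T\<rrangle>"
proof -
  interpret linear_reflexive_object C U \<A> \<L> by (rule assms(1))
  have "fvs (rep_dterm S) \<subseteq> set (y # xs)" "fvs (rep_dterm T) \<subseteq> set xs"
    using assms(4,5) by (simp_all add: adequate_def fvars.rep_eq)
  note raw = raw_subst_dens[OF this]
  have "subst S T y = abs_dterm (raw_subst (rep_dterm S) (rep_dterm T) y)"
    by (simp add: subst_def)
  \<comment> \<open>\<open>interp_abs\<close> replaces the chosen representative of the substituted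
    class by \<open>raw_subst\<close> of the representatives of \<open>S\<close> and
    \<open>T\<close>.\<close>
  then show ?thesis using raw by (simp add: interp_abs interp_def[symmetric])
qed

end
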